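(* Let $\Gamma\subset\mathbb{R}$ be a countable dense additive subgroup and let $\Delta\subset\mathbb{R}$ be a countable dense subset containing $0$ which is invariant under translation by $\Gamma$. Let $\mathcal{H}:=\mathbb{R}_\Delta\rtimes\Gamma$ be the transformation groupoid of the translation action. When $\operatorname{rank}\Gamma\geq3$, the action $\Gamma\curvearrowright\mathbb{R}_\Delta$ is $H^1$-rigid. In other words, the natural homomorphism $\mathcal{H}\to\Gamma$ induces an isomorphism between $H^1(\mathcal{H})$ and $H^1(\Gamma)=\operatorname{Hom}(\Gamma,\mathbb{Z})$.
   Context: $\operatorname{rank}\Gamma:=\dim_{\mathbb{Q}}(\Gamma\otimes\mathbb{Q})$ (possibly infinite). For a countable dense subset $\Delta\subset\mathbb{R}$, the space $\mathbb{R}_\Delta$ is, as a set, $(\mathbb{R}\setminus\Delta)\sqcup\{t_+,t_-\mid t\in\Delta\}$, with the canonical surjection $q:\mathbb{R}_\Delta\to\mathbb{R}$ ($q(t_\pm)=t$, $q(x)=x$ for $x\notin\Delta$), the total order such that $q(x)<q(y)$ implies $x<y$ and $t_-<t_+$ for $t\in\Delta$, and the order topology. It is totally disconnected and locally compact Hausdorff; the sets $[t_+,s_-]$ ($t<s$ in $\Delta$) are compact open and form a basis. If $\Delta+\Gamma\subset\Delta$, then $\Gamma$ acts on $\mathbb{R}_\Delta$ by translation: $s\cdot x=x+s$ for $x\in\mathbb{R}\setminus\Delta$, $s\cdot t_\pm=(t+s)_\pm$. For an action of a discrete group $G$ on $X$, the transformation groupoid $X\rtimes G$ is $X\times G$ with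 the product topology, unit space $X$ (identified with $X\times\{1\}$), $r(x,\gamma)=x$, $s(x,\gamma)=\gamma^{-1}x$, $(x,\gamma)(\gamma^{-1}x,\gamma')=(x,\gamma\gamma')$; the natural homomorphism $\pi:X\rtimes G\to G$ is $\pi(x,\gamma)=\gamma$. For an ample groupoid $\mathcal{G}$, $H^1(\mathcal{G})=H^1(\mathcal{G},\mathbb{Z})$ is the group of continuous homomorphisms $\xi:\mathcal{G}\to\mathbb{Z}$ modulo coboundaries, i.e. homomorphisms of the form $g\mapsto f(r(g))-f(s(g))$ with $f:\mathcal{G}^{(0)}\to\mathbb{Z}$ continuous. A homomorphism $\pi$ induces $H^1(\pi):[\xi]\mapsto[\xi\circ\pi]$. An action $G\curvearrowright X$ is $H^1$-rigid if $H^1(\pi):\operatorname{Hom}(G,\mathbb{Z})=H^1(G)\to H^1(X\rtimes G)$ is an isomorphism. *)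

theory Defs
  imports
    "HOL-Analysis.Analysis"
    "HOL-Algebra.Elementary_Groups"
    "HOL-Algebra.Free_Abelian_Groups"
    "HOL-Algebra.Module"
    "HOL-Library.Extended_Nat"
begin

definition rat_field :: "rat ring" where
  "rat_field = \<lparr>carrier = UNIV, monoid.mult = (*), one = 1, zero = 0, add = (+)\<rparr>"

text \<open>
  The tensor product over the integers of an abelian group with the rationals: the free abelian
  group on pairs modulo the biadditivity relations. The product of a scalar \<open>q\<close> and a class is
  induced by \<open>g \<otimes> r \<mapsto> g \<otimes> q r\<close>; the union below is over equal cosets. A module record
  extends a ring record, so it has two further fields, which no module notion refers to.
\<close>

definition tensor_rels :: "'g monoid \<Rightarrow> ('g \<times> rat \<Rightarrow>\<^sub>0 int) set" where
  "tensor_rels G = generate (free_Abelian_group (carrier G \<times> UNIV))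
     ({frag_of (a \<otimes>\<^bsub>G\<^esub> b, r) - frag_of (a, r) - frag_of (b, r) | a b r.
         a \<in> carrier G \<and> b \<in> carrier G} \<union>
      {frag_of (a, r + r') - frag_of (a, r) - frag_of (a, r') | a r r'. a \<in> carrier G})"

definition tensor_rat :: "'g monoid \<Rightarrow> (rat, ('g \<times> rat \<Rightarrow>\<^sub>0 int) set) module" where
  "tensor_rat G =
     (let F = free_Abelian_group (carrier G \<times> UNIV); N = tensor_rels G in
      \<lparr>carrier = carrier (F Mod N), monoid.mult = undefined, one = undefined,
       zero = \<one>\<^bsub>F Mod N\<^esub>, add = (\<otimes>\<^bsub>F Mod N\<^esub>),
       smult = (\<lambda>q C. \<Union>x\<in>C. N #>\<^bsub>F\<^esub> frag_extend (\<lambda>(g, r). frag_of (g, q * r)) x)\<rparr>)"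

definition lin_independent :: "'k ring \<Rightarrow> ('k, 'v) module \<Rightarrow> 'v set \<Rightarrow> bool" where
  "lin_independent K V B \<longleftrightarrow> finite B \<and> B \<subseteq> carrier V \<and>
     (\<forall>c \<in> B \<rightarrow> carrier K.
        (\<Oplus>\<^bsub>V\<^esub>b\<in>B. c b \<odot>\<^bsub>V\<^esub> b) = \<zero>\<^bsub>V\<^esub> \<longrightarrow> (\<forall>b\<in>B. c b = \<zero>\<^bsub>K\<^esub>))"

text \<open>All infinite dimensions are identified.\<close>

definition vs_dim :: "'k ring \<Rightarrow> ('k, 'v) module \<Rightarrow> enat" where
  "vs_dim K V = (SUP B \<in> {B. lin_independent K V B}. enat (card B))"

definition group_rank :: "'g monoid \<Rightarrow> enat" where
  "group_rank G = vs_dim rat_field (tensor_rat G)"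

text \<open>
  The units are a subset of the arrows, with the subspace topology. Only the values of
  \<open>gcomp g h\<close> with \<open>src g = rng h\<close> are meaningful.
\<close>

record 'a top_groupoid =
  arr_top :: "'a topology"
  gunits :: "'a set"
  rng :: "'a \<Rightarrow> 'a"
  src :: "'a \<Rightarrow> 'a"
  gcomp :: "'a \<Rightarrow> 'a \<Rightarrow> 'a"

abbreviation arrows :: "'a top_groupoid \<Rightarrow> 'a set" where
  "arrows \<G> \<equiv> topspace (arr_top \<G>)"

definition unit_top :: "'a top_groupoid \<Rightarrow> 'a topology" where
  "unit_top \<G> = subtopology (arr_top \<G>) (gunits \<G>)"

text \<open>
  Functions on arrows are extensional (\<open>undefined\<close> off the arrows), so that equality of functions
  is equality on the groupoid.
\<close>

definition int_homs :: "'a top_groupoid \<Rightarrow> ('a \<Rightarrow> int) set" where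
  "int_homs \<G> = {\<xi> \<in> extensional (arrows \<G>).
     continuous_map (arr_top \<G>) (discrete_topology UNIV) \<xi> \<and>
     (\<forall>g\<in>arrows \<G>. \<forall>h\<in>arrows \<G>. src \<G> g = rng \<G> h \<longrightarrow>
        \<xi> (gcomp \<G> g h) = \<xi> g + \<xi> h)}"

definition Z1 :: "'a top_groupoid \<Rightarrow> ('a \<Rightarrow> int) monoid" where
  "Z1 \<G> = \<lparr>carrier = int_homs \<G>,
     monoid.mult = (\<lambda>\<xi> \<eta>. \<lambda>g\<in>arrows \<G>. \<xi> g + \<eta> g), one = (\<lambda>g\<in>arrows \<G>. 0)\<rparr>"

definition B1 :: "'a top_groupoid \<Rightarrow> ('a \<Rightarrow> int) set" where
  "B1 \<G> = {(\<lambda>g\<in>arrows \<G>. f (rng \<G> g) - f (src \<G> g)) | f.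
     continuous_map (unit_top \<G>) (discrete_topology UNIV) f}"

definition H1 :: "'a top_groupoid \<Rightarrow> ('a \<Rightarrow> int) set monoid" where
  "H1 \<G> = Z1 \<G> Mod B1 \<G>"

definition H1_class :: "'a top_groupoid \<Rightarrow> ('a \<Rightarrow> int) \<Rightarrow> ('a \<Rightarrow> int) set" where
  "H1_class \<G> \<xi> = B1 \<G> #>\<^bsub>Z1 \<G>\<^esub> (restrict \<xi> (arrows \<G>))"

text \<open>
  For a continuous homomorphism \<open>\<pi>\<close>, the classes of \<open>\<xi> \<circ> \<pi>\<close> for \<open>\<xi>\<close> in a given coset \<open>C\<close> all agree.
\<close>

definition H1_map ::
  "'a top_groupoid \<Rightarrow> ('a \<Rightarrow> 'b) \<Rightarrow> ('b \<Rightarrow> int) set \<Rightarrow> ('a \<Rightarrow> int) set" where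
  "H1_map \<G> \<pi> C = the_elem ((\<lambda>\<xi>. H1_class \<G> (\<xi> \<circ> \<pi>)) ` C)"

definition group_groupoid :: "'g monoid \<Rightarrow> 'g top_groupoid" where
  "group_groupoid G = \<lparr>arr_top = discrete_topology (carrier G), gunits = {\<one>\<^bsub>G\<^esub>},
     rng = (\<lambda>_. \<one>\<^bsub>G\<^esub>), src = (\<lambda>_. \<one>\<^bsub>G\<^esub>), gcomp = (\<otimes>\<^bsub>G\<^esub>)\<rparr>"

definition transformation_groupoid ::
  "'x topology \<Rightarrow> 'g monoid \<Rightarrow> ('g \<Rightarrow> 'x \<Rightarrow> 'x) \<Rightarrow> ('x \<times> 'g) top_groupoid" where
  "transformation_groupoid X G act =
     \<lparr>arr_top = prod_topology X (discrete_topology (carrier G)),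
      gunits = topspace X \<times> {\<one>\<^bsub>G\<^esub>},
      rng = (\<lambda>(x, g). (x, \<one>\<^bsub>G\<^esub>)),
      src = (\<lambda>(x, g). (act (inv\<^bsub>G\<^esub> g) x, \<one>\<^bsub>G\<^esub>)),
      gcomp = (\<lambda>(x, g) (y, h). (x, g \<otimes>\<^bsub>G\<^esub> h))\<rparr>"

definition Hom_int :: "'g monoid \<Rightarrow> ('g \<Rightarrow> int) monoid" where
  "Hom_int G = \<lparr>carrier = hom G integer_group \<inter> extensional (carrier G),
     monoid.mult = (\<lambda>\<phi> \<psi>. \<lambda>g\<in>carrier G. \<phi> g + \<psi> g), one = (\<lambda>g\<in>carrier G. 0)\<rparr>"

definition H1_rigid :: "'x topology \<Rightarrow> 'g monoid \<Rightarrow> ('g \<Rightarrow> 'x \<Rightarrow> 'x) \<Rightarrow> bool" where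
  "H1_rigid X G act \<longleftrightarrow>
     H1_map (transformation_groupoid X G act) snd
       \<in> iso (H1 (group_groupoid G)) (H1 (transformation_groupoid X G act))"

definition order_topology_on :: "'a set \<Rightarrow> ('a \<Rightarrow> 'a \<Rightarrow> bool) \<Rightarrow> 'a topology" where
  "order_topology_on X lt = topology_generated_by
     ({X} \<union> {{y \<in> X. lt x y} | x. x \<in> X} \<union> {{y \<in> X. lt y x} | x. x \<in> X})"

text \<open>\<open>Minus t\<close> and \<open>Plus t\<close> are the points \<open>t\<^sub>-\<close> and \<open>t\<^sub>+\<close>.\<close>

datatype split_point = Regular real | Minus real | Plus real

fun split_proj :: "split_point \<Rightarrow> real" where
  "split_proj (Regular x) = x"
| "split_proj (Minus t) = t"
| "split_proj (Plus t) = t"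

definition split_set :: "real set \<Rightarrow> split_point set" where
  "split_set \<Delta> = Regular ` (- \<Delta>) \<union> Minus ` \<Delta> \<union> Plus ` \<Delta>"

definition split_less :: "split_point \<Rightarrow> split_point \<Rightarrow> bool" where
  "split_less x y \<longleftrightarrow> split_proj x < split_proj y \<or> (\<exists>t. x = Minus t \<and> y = Plus t)"

definition split_line :: "real set \<Rightarrow> split_point topology" where
  "split_line \<Delta> = order_topology_on (split_set \<Delta>) split_less"

fun split_translate :: "real \<Rightarrow> split_point \<Rightarrow> split_point" where
  "split_translate s (Regular x) = Regular (x + s)"
| "split_translate s (Minus t) = Minus (t + s)"
| "split_translate s (Plus t) = Plus (t + s)"

definition add_group :: "'a::ab_group_add set \<Rightarrow> 'a monoid" where
  "add_group A = \<lparr>carrier = A, monoid.mult = (+), one = 0\<rparr>"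

end

theory Submission
  imports Defs
begin

text \<open>
A continuous function \<open>f : \<real>\<^sub>\<Delta> \<rightarrow> \<int>\<close> is a step function on the line: it is determined up to a
constant by its jumps \<open>f t\<^sub>+ - f t\<^sub>-\<close>, which vanish off a sparse (closed and discrete) subset of \<open>\<Delta>\<close>,
and every integer function on \<open>\<Delta>\<close> of sparse support occurs. So there is an exact sequence of
\<open>\<Gamma>\<close>-modules \<open>0 \<rightarrow> \<int> \<rightarrow> C(\<real>\<^sub>\<Delta>, \<int>) \<rightarrow> L \<rightarrow> 0\<close>, where \<open>L\<close> is the module of functions on \<open>\<Delta>\<close> of
sparse support. The groupoid cohomology \<open>H\<^sup>1\<close> is the group cohomology of \<open>\<Gamma>\<close> with coefficients in
\<open>C(\<real>\<^sub>\<Delta>, \<int>)\<close>, so the map from \<open>Hom(\<Gamma>, \<int>)\<close> is injective because \<open>H\<^sup>0(\<Gamma>, L) = 0\<close>, and surjective because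
\<open>H\<^sup>1(\<Gamma>, L) = 0\<close>.

The first vanishing holds since an orbit of \<open>\<Gamma>\<close> is not sparse (\<open>invariant_sparse_empty\<close>). The second is
where the rank enters. A cocycle with values in \<open>L\<close> is the coboundary of some function \<open>F\<close>
of arbitrary support, because all functions form a coinduced module
(\<open>add_subgroup_cocycle_is_coboundary\<close>); every translation changes \<open>F\<close> on a sparse set only, and \<open>F\<close> has to
be corrected by an invariant function to sparse support. Choose independent \<open>a, b, c \<in> \<Gamma>\<close>, which
exist when the rank is at least three (\<open>group_rank_ge_3_imp_int_independent\<close>). Modulo \<open>a\<close>, an orbit of the
subgroup they generate becomes a copy of \<open>\<int>\<^sup>2\<close> on a circle, where compactness turns sparse into
finite. As \<open>\<int>\<^sup>2\<close> has only one end, a function on it with finitely many changes is constant off a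
finite set (\<open>finite_differences_imp_const_off_finite\<close>), and these constants are the invariant function
(\<open>sparse_differences_imp_invariant_off_sparse\<close>). For rank two the orbits would be copies of \<open>\<int>\<close>, which has
two ends, and the argument breaks down.

The pieces are put together in \<open>split_line_cocycle_decomposition\<close> and
\<open>split_line_coboundary_character_zero\<close>; \<open>H1_class_iso\<close> translates them into cohomology.
\<close>

section \<open>Additive groups of rank at least three\<close>

definition int_independent :: "real \<Rightarrow> real \<Rightarrow> real \<Rightarrow> bool" where
  "int_independent a b c \<longleftrightarrow>
     (\<forall>k l m :: int. of_int k * a + of_int l * b + of_int m * c = 0 \<longrightarrow> k = 0 \<and> l = 0 \<and> m = 0)"

lemma subgroup_add_groupD:
  assumes "subgroup A (add_group UNIV)"
  shows "0 \<in> A" "a \<in> A \<Longrightarrow> b \<in> A \<Longrightarrow> a + b \<in> A" "a \<in> A \<Longrightarrow> - a \<in> A"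
    "a \<in> A \<Longrightarrow> b \<in> A \<Longrightarrow> a - b \<in> A"
proof -
  have grp: "Group.group (add_group (UNIV :: 'a set))"
    by (rule groupI) (auto simp: add_group_def add.assoc intro: exI[of _ "- x" for x])
  have inv: "inv\<^bsub>add_group UNIV\<^esub> a = - a" for a :: 'a
    by (rule group.inv_equality[OF grp]) (auto simp: add_group_def)
  show "0 \<in> A"
    using subgroup.one_closed[OF assms] by (simp add: add_group_def)
  show add: "a + b \<in> A" if "a \<in> A" "b \<in> A" for a b
    using subgroup.m_closed[OF assms that] by (simp add: add_group_def)
  show neg: "- a \<in> A" if "a \<in> A" for a
    using subgroup.m_inv_closed[OF assms that] by (simp add: inv)
  show "a - b \<in> A" if "a \<in> A" "b \<in> A" for a b
    using add[OF that(1) neg[OF that(2)]] by simp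
qed

lemma shift_invariant_mem_iff:
  assumes A: "subgroup A (add_group UNIV)" and inv: "\<And>t s. t \<in> \<Delta> \<Longrightarrow> s \<in> A \<Longrightarrow> t + s \<in> \<Delta>"
    and s: "s \<in> A"
  shows "x + s \<in> \<Delta> \<longleftrightarrow> x \<in> \<Delta>"
  using inv[of x s] inv[of "x + s" "- s"] subgroup_add_groupD(3)[OF A s] s by auto

lemma add_group_simps [simp]:
  "carrier (add_group A) = A" "x \<otimes>\<^bsub>add_group A\<^esub> y = x + y" "\<one>\<^bsub>add_group A\<^esub> = 0"
  by (simp_all add: add_group_def)

lemma comm_group_add_group:
  assumes "subgroup A (add_group UNIV)"
  shows "comm_group (add_group A)"
  by (rule comm_groupI)
     (use subgroup_add_groupD[OF assms] in \<open>auto simp: algebra_simps intro: bexI[of _ "- x" for x]\<close>)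

lemma inv_add_group:
  assumes "subgroup A (add_group UNIV)" "a \<in> A"
  shows "inv\<^bsub>add_group A\<^esub> a = - a"
  by (rule group.inv_equality)
     (use assms comm_group_add_group comm_group.axioms(2) subgroup_add_groupD in auto)

lemma of_int_mult_closed:
  assumes "subgroup A (add_group UNIV)" "(a :: 'a :: ring_1) \<in> A"
  shows "of_int k * a \<in> A"
proof (induction k rule: int_induct[of _ 0])
  case (step1 i)
  then show ?case
    using subgroup_add_groupD(2)[OF assms(1) step1.IH assms(2)] by (simp add: algebra_simps)
next
  case (step2 i)
  then show ?case
    using subgroup_add_groupD(4)[OF assms(1) step2.IH assms(2)] by (simp add: algebra_simps)
qed (use subgroup_add_groupD(1)[OF assms(1)] in auto)

context
  fixes A :: "real set"
  assumes A: "subgroup A (add_group UNIV)"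
begin

private abbreviation "F \<equiv> free_Abelian_group (A \<times> (UNIV :: rat set))"
private abbreviation "N \<equiv> tensor_rels (add_group A)"
private abbreviation "V \<equiv> tensor_rat (add_group A)"

definition simple_tensor :: "real \<Rightarrow> rat \<Rightarrow> (real \<times> rat \<Rightarrow>\<^sub>0 int) set" where
  "simple_tensor a r = N #>\<^bsub>F\<^esub> frag_of (a, r)"

lemma tensor_relators_in_carrier:
  "{frag_of (a + b, r) - frag_of (a, r) - frag_of (b, r) | a b r. a \<in> A \<and> b \<in> A} \<union>
   {frag_of (a, r + r') - frag_of (a, r) - frag_of (a, r') | a r r'. a \<in> A} \<subseteq> carrier F"
  using subgroup_add_groupD[OF A]
  by (auto dest!: set_mp[OF keys_diff] split: if_splits)

lemma tensor_rels_eq: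
  "N = generate F
   ({frag_of (a + b, r) - frag_of (a, r) - frag_of (b, r) | a b r. a \<in> A \<and> b \<in> A} \<union>
    {frag_of (a, r + r') - frag_of (a, r) - frag_of (a, r') | a r r'. a \<in> A})"
  by (simp add: tensor_rels_def)

lemma normal_tensor_rels: "N \<lhd> F"
  unfolding tensor_rels_eq
  using tensor_relators_in_carrier
  by (intro comm_group.subgroup_imp_normal[OF abelian_free_Abelian_group]
        group.generate_is_subgroup) auto

lemma tensor_rat_simps:
  "carrier V = rcosets\<^bsub>F\<^esub> N" "\<zero>\<^bsub>V\<^esub> = N" "x \<oplus>\<^bsub>V\<^esub> y = x <#>\<^bsub>F\<^esub> y"
  by (simp_all add: tensor_rat_def Let_def FactGroup_def)

lemma abelian_group_tensor_rat: "abelian_group V"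
proof -
  have "comm_group (F Mod N)"
    using comm_group.abelian_FactGroup[OF abelian_free_Abelian_group]
      normal_imp_subgroup[OF normal_tensor_rels] by blast
  then interpret Q: comm_group "F Mod N" .
  show ?thesis
    by (rule abelian_groupI)
       (use Q.m_closed Q.one_closed Q.m_assoc Q.m_comm Q.l_one Q.l_inv_ex in
         \<open>simp_all add: tensor_rat_simps FactGroup_def\<close>)
qed

lemma coset_add:
  assumes "x \<in> carrier F" "y \<in> carrier F"
  shows "(N #>\<^bsub>F\<^esub> x) \<oplus>\<^bsub>V\<^esub> (N #>\<^bsub>F\<^esub> y) = N #>\<^bsub>F\<^esub> (x + y)"
  using normal.rcos_sum[OF normal_tensor_rels assms] by (simp add: tensor_rat_simps)

lemma coset_eqI:
  assumes "x \<in> carrier F" "y \<in> carrier F" "x - y \<in> N"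
  shows "N #>\<^bsub>F\<^esub> x = N #>\<^bsub>F\<^esub> y"
proof -
  have sub: "subgroup N F" using normal_imp_subgroup[OF normal_tensor_rels] .
  have "x \<in> N #>\<^bsub>F\<^esub> y"
    using subgroup.rcos_module_rev[OF sub group_free_Abelian_group assms(2,1)] assms by simp
  then show ?thesis
    using group.repr_independence[OF group_free_Abelian_group _ assms(2) sub] by simp
qed

lemma coset_in_carrier: "x \<in> carrier F \<Longrightarrow> N #>\<^bsub>F\<^esub> x \<in> carrier V"
  unfolding tensor_rat_simps RCOSETS_def by blast

lemma simple_tensor_closed [simp]: "a \<in> A \<Longrightarrow> simple_tensor a r \<in> carrier V"
  unfolding simple_tensor_def by (rule coset_in_carrier) simp

lemma simple_tensor_add_left:
  assumes "a \<in> A" "b \<in> A"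
  shows "simple_tensor (a + b) r = simple_tensor a r \<oplus>\<^bsub>V\<^esub> simple_tensor b r"
proof -
  have c: "frag_of (a + b, r) \<in> carrier F" "frag_of (a, r) \<in> carrier F" "frag_of (b, r) \<in> carrier F"
    using assms subgroup_add_groupD[OF A] by auto
  have "frag_of (a + b, r) - frag_of (a, r) - frag_of (b, r) \<in> N"
    unfolding tensor_rels_eq by (rule generate.incl) (use assms in blast)
  then show ?thesis
    using c keys_add[of "frag_of (a, r)" "frag_of (b, r)"]
    unfolding simple_tensor_def coset_add[OF c(2,3)]
    by (intro coset_eqI) (auto simp: algebra_simps)
qed

lemma simple_tensor_add_right:
  assumes "a \<in> A"
  shows "simple_tensor a (r + r') = simple_tensor a r \<oplus>\<^bsub>V\<^esub> simple_tensor a r'"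
proof -
  have c: "frag_of (a, r + r') \<in> carrier F" "frag_of (a, r) \<in> carrier F" "frag_of (a, r') \<in> carrier F"
    using assms by auto
  have "frag_of (a, r + r') - frag_of (a, r) - frag_of (a, r') \<in> N"
    unfolding tensor_rels_eq by (rule generate.incl) (use assms in blast)
  then show ?thesis
    using c keys_add[of "frag_of (a, r)" "frag_of (a, r')"]
    unfolding simple_tensor_def coset_add[OF c(2,3)]
    by (intro coset_eqI) (auto simp: algebra_simps)
qed

lemma simple_tensor_zero_left [simp]: "simple_tensor 0 r = \<zero>\<^bsub>V\<^esub>"
proof -
  interpret V: abelian_group V by (rule abelian_group_tensor_rat)
  have "0 \<in> A" using subgroup_add_groupD[OF A] by auto
  then show ?thesis
    using simple_tensor_add_left[of 0 0 r] V.add.l_cancel_one by fastforce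
qed

lemma simple_tensor_zero_right [simp]: "a \<in> A \<Longrightarrow> simple_tensor a 0 = \<zero>\<^bsub>V\<^esub>"
proof -
  interpret V: abelian_group V by (rule abelian_group_tensor_rat)
  show "a \<in> A \<Longrightarrow> simple_tensor a 0 = \<zero>\<^bsub>V\<^esub>"
    using simple_tensor_add_right[of a 0 0] V.add.l_cancel_one by fastforce
qed

lemma simple_tensor_of_int:
  assumes a: "a \<in> A"
  shows "simple_tensor (of_int k * a) r = simple_tensor a (of_int k * r)"
proof -
  interpret V: abelian_group V by (rule abelian_group_tensor_rat)
  have k: "of_int k * a \<in> A" for k
    using of_int_mult_closed[OF A a] .
  show ?thesis
  proof (induction k rule: int_induct[of _ 0])
    case base
    then show ?case using a by simp
  next
    case (step1 i)
    then show ?case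
      using simple_tensor_add_left[OF k[of i] a, of r]
        simple_tensor_add_right[OF a, of "of_int i * r" r]
      by (simp add: algebra_simps)
  next
    case (step2 i)
    have "simple_tensor (of_int (i - 1) * a) r \<oplus>\<^bsub>V\<^esub> simple_tensor a r
        = simple_tensor a (of_int (i - 1) * r) \<oplus>\<^bsub>V\<^esub> simple_tensor a r"
      using step2 simple_tensor_add_left[OF k[of "i - 1"] a, of r]
        simple_tensor_add_right[OF a, of "of_int (i - 1) * r" r]
      by (simp add: algebra_simps)
    then show ?case
      using a k[of "i - 1"] by (simp del: of_int_diff)
  qed
qed

lemma frag_extend_scale_relator:
  fixes h :: "real \<times> rat \<Rightarrow>\<^sub>0 int"
  assumes "h \<in> {frag_of (a + b, r) - frag_of (a, r) - frag_of (b, r) | a b r. a \<in> A \<and> b \<in> A} \<union>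
    {frag_of (a, r + r') - frag_of (a, r) - frag_of (a, r') | a r r'. a \<in> A}" (is "h \<in> ?R1 \<union> ?R2")
  shows "frag_extend (\<lambda>(g, r). frag_of (g, q * r)) h \<in> ?R1 \<union> ?R2"
  using assms
proof
  assume "h \<in> ?R1"
  then show ?thesis
    by (intro UnI1) (force simp: frag_extend_diff)
next
  assume "h \<in> ?R2"
  then obtain a r r' where "a \<in> A" "h = frag_of (a, r + r') - frag_of (a, r) - frag_of (a, r')"
    by blast
  then have "frag_extend (\<lambda>(g, r). frag_of (g, q * r)) h
      = frag_of (a, q * r + q * r') - frag_of (a, q * r) - frag_of (a, q * r')"
    by (simp add: frag_extend_diff ring_distribs)
  then show ?thesis using \<open>a \<in> A\<close> by blast
qed

text \<open>
Scaling the rational component maps biadditivity relators to biadditivity relators, which is why the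
scalar multiplication of the tensor product is well defined.
\<close>

lemma frag_extend_scale_in_tensor_rels:
  assumes "x \<in> N"
  shows "frag_extend (\<lambda>(g, r). frag_of (g, q * r)) x \<in> N"
  using assms unfolding tensor_rels_eq
proof (induction rule: generate.induct)
  case one
  show ?case
    using generate.one[of F] by simp
next
  case (incl h)
  then show ?case
    by (intro generate.incl frag_extend_scale_relator)
next
  case (inv h)
  have h: "h \<in> carrier F" using inv tensor_relators_in_carrier by blast
  have "frag_extend (\<lambda>(g, r). frag_of (g, q * r)) h \<in> carrier F"
    using frag_extend_scale_relator[OF inv] tensor_relators_in_carrier by blast
  then show ?case
    using generate.inv[OF frag_extend_scale_relator[OF inv, of q], of F] h
    by (simp add: frag_extend_minus)
next
  case (eng h1 h2)
  then show ?case
    using generate.eng[OF eng.IH] by (simp add: frag_extend_add)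
qed

text \<open>
The union in the scalar multiplication runs over cosets that are all equal, because scaling respects
the relations.
\<close>

lemma smult_simple_tensor:
  assumes "a \<in> A"
  shows "q \<odot>\<^bsub>V\<^esub> simple_tensor a r = simple_tensor a (q * r)"
proof -
  let ?T = "frag_extend (\<lambda>(g, r). frag_of (g, q * r))"
  have sub: "subgroup N F" using normal_imp_subgroup[OF normal_tensor_rels] .
  have NF: "N \<subseteq> carrier F" using subgroup.subset[OF sub] .
  have "N #>\<^bsub>F\<^esub> ?T x = simple_tensor a (q * r)" if x: "x \<in> simple_tensor a r" for x
  proof -
    obtain n where n: "n \<in> N" "x = n + frag_of (a, r)"
      using x by (auto simp: simple_tensor_def r_coset_def)
    then have T: "?T x = ?T n + frag_of (a, q * r)" by (simp add: frag_extend_add)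
    have "?T n \<in> N" using n frag_extend_scale_in_tensor_rels by blast
    then show ?thesis
      unfolding simple_tensor_def T
      using assms subsetD[OF NF, of "?T n"] subset_trans[OF keys_add[of "?T n" "frag_of (a, q * r)"]]
      by (intro coset_eqI) auto
  qed
  moreover have "frag_of (a, r) \<in> simple_tensor a r"
    unfolding simple_tensor_def
    by (rule group.rcos_self[OF group_free_Abelian_group _ sub]) (use assms in simp)
  ultimately have "(\<Union>x\<in>simple_tensor a r. N #>\<^bsub>F\<^esub> ?T x) = simple_tensor a (q * r)"
    by blast
  then show ?thesis
    by (simp add: tensor_rat_def Let_def)
qed

text \<open>
Common denominators turn a difference of simple tensors into a simple tensor:
\<open>a \<otimes> 1/m - b \<otimes> 1/n = (n a - m b) \<otimes> 1/(m n)\<close>.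
\<close>

lemma tensor_rat_simple:
  assumes "C \<in> carrier V"
  shows "\<exists>a\<in>A. \<exists>n::int. n > 0 \<and> C = simple_tensor a (1 / of_int n)"
proof -
  interpret V: abelian_group V by (rule abelian_group_tensor_rat)
  obtain x where x: "Poly_Mapping.keys x \<subseteq> A \<times> UNIV" "C = N #>\<^bsub>F\<^esub> x"
    using assms by (auto simp: tensor_rat_simps RCOSETS_def)
  have "\<exists>a\<in>A. \<exists>n::int. n > 0 \<and> N #>\<^bsub>F\<^esub> x = simple_tensor a (1 / of_int n)"
  proof (rule free_Abelian_group_induct[OF x(1)])
    have "N #>\<^bsub>F\<^esub> 0 = \<zero>\<^bsub>V\<^esub>"
      using group.coset_mult_one[OF group_free_Abelian_group, of N] 
       subgroup.subset[OF normal_imp_subgroup[OF normal_tensor_rels]]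
      by (simp add: tensor_rat_simps)
    then show "\<exists>a\<in>A. \<exists>n::int. n > 0 \<and> N #>\<^bsub>F\<^esub> 0 = simple_tensor a (1 / of_int n)"
      using subgroup_add_groupD(1)[OF A] by (intro bexI[of _ 0] exI[of _ 1]) auto
  next
    fix x y
    assume 2: "Poly_Mapping.keys x \<subseteq> A \<times> UNIV" "Poly_Mapping.keys y \<subseteq> A \<times> UNIV"
      "\<exists>a\<in>A. \<exists>n::int. n > 0 \<and> N #>\<^bsub>F\<^esub> x = simple_tensor a (1 / of_int n)"
      "\<exists>a\<in>A. \<exists>n::int. n > 0 \<and> N #>\<^bsub>F\<^esub> y = simple_tensor a (1 / of_int n)"
    then obtain a m b n where *: "a \<in> A" "m > (0::int)" "N #>\<^bsub>F\<^esub> x = simple_tensor a (1 / of_int m)"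
      "b \<in> A" "n > (0::int)" "N #>\<^bsub>F\<^esub> y = simple_tensor b (1 / of_int n)"
      by blast
    let ?c = "of_int n * a - of_int m * b" and ?r = "1 / of_int (m * n) :: rat"
    have na: "of_int n * a \<in> A" and mb: "of_int m * b \<in> A" and c: "?c \<in> A"
      using * of_int_mult_closed[OF A] subgroup_add_groupD(4)[OF A] by auto
    have sc: "simple_tensor (of_int n * a) ?r = N #>\<^bsub>F\<^esub> x" "simple_tensor (of_int m * b) ?r = N #>\<^bsub>F\<^esub> y"
      using * by (simp_all add: simple_tensor_of_int)
    have xy: "x - y \<in> carrier F"
      using 2 keys_diff[of x y] by auto
    have "(N #>\<^bsub>F\<^esub> (x - y)) \<oplus>\<^bsub>V\<^esub> (N #>\<^bsub>F\<^esub> y) = simple_tensor ?c ?r \<oplus>\<^bsub>V\<^esub> (N #>\<^bsub>F\<^esub> y)"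
      using coset_add[OF xy, of y] 2(2) simple_tensor_add_left[OF c mb, of ?r, unfolded sc]
      by (simp add: sc(1)[symmetric])
    then have "N #>\<^bsub>F\<^esub> (x - y) = simple_tensor ?c ?r"
      using V.add.right_cancel[of "N #>\<^bsub>F\<^esub> y" "N #>\<^bsub>F\<^esub> (x - y)" "simple_tensor ?c ?r"]
       coset_in_carrier[OF xy] coset_in_carrier[of y] 2 simple_tensor_closed[OF c] by simp
    then show "\<exists>a\<in>A. \<exists>n::int. n > 0 \<and> N #>\<^bsub>F\<^esub> (x - y) = simple_tensor a (1 / of_int n)"
      using c * by (intro bexI[of _ ?c] exI[of _ "m * n"]) auto
  next
    fix z assume "z \<in> A \<times> (UNIV :: rat set)"
    then obtain a r where z: "z = (a, r)" "a \<in> A" by auto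
    obtain k n where r: "r = of_int k / of_int n" "n > (0::int)"
      using quotient_of_div[of r] quotient_of_denom_pos[of r] by (cases "quotient_of r") auto
    have "N #>\<^bsub>F\<^esub> frag_of z = simple_tensor (of_int k * a) (1 / of_int n)"
      using z r by (simp add: simple_tensor_of_int) (simp add: simple_tensor_def)
    then show "\<exists>a\<in>A. \<exists>n::int. n > 0 \<and> N #>\<^bsub>F\<^esub> frag_of z = simple_tensor a (1 / of_int n)"
      using r of_int_mult_closed[OF A z(2)] by blast
  qed
  then show ?thesis using x by blast
qed

end

text \<open>
Every element of \<open>A \<otimes> \<rat>\<close> is \<open>g \<otimes> 1/n\<close>, so three rationally independent tensors come from three
elements \<open>g\<close> of \<open>A\<close>, and an integral relation between these, once the denominators are put
into the coefficients, is a rational relation between the tensors.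
\<close>

lemma group_rank_ge_3_imp_int_independent:
  assumes A: "subgroup A (add_group UNIV)" and rank: "group_rank (add_group A) \<ge> 3"
  shows "\<exists>a\<in>A. \<exists>b\<in>A. \<exists>c\<in>A. int_independent a b c"
proof -
  let ?V = "tensor_rat (add_group A)"
  interpret V: abelian_group ?V by (rule abelian_group_tensor_rat[OF A])
  have "\<exists>B. lin_independent rat_field ?V B \<and> 3 \<le> card B"
  proof (rule ccontr)
    assume "\<not> ?thesis"
    then have "\<And>B. lin_independent rat_field ?V B \<Longrightarrow> card B \<le> 2" by fastforce
    then have "group_rank (add_group A) \<le> enat 2"
      unfolding group_rank_def vs_dim_def by (intro SUP_least) auto
    then have "(3::enat) \<le> enat 2" using rank order_trans by blast
    then show False by (simp add: numeral_eq_enat)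
  qed
  then obtain B where B: "lin_independent rat_field ?V B" "3 \<le> card B" by blast
  obtain E where "E \<subseteq> B" "card E = 3"
    using obtain_subset_with_card_n[OF B(2)] by metis
  then obtain x y z where E: "E = {x, y, z}" "x \<noteq> y" "x \<noteq> z" "y \<noteq> z" "{x, y, z} \<subseteq> B"
    by (auto simp: card_3_iff)
  have carr: "B \<subseteq> carrier ?V" and fin: "finite B"
    using B by (auto simp: lin_independent_def)
  have simple: "\<exists>a\<in>A. \<exists>n::int. n > 0 \<and> v = simple_tensor A a (1 / of_int n)" if "v \<in> B" for v
    using tensor_rat_simple[OF A] carr that by blast
  have "x \<in> B" "y \<in> B" "z \<in> B" using E by auto
  then obtain a i b j c k where abc: "a \<in> A" "b \<in> A" "c \<in> A" "i > (0::int)" "j > (0::int)" "k > (0::int)"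
    and xyz: "x = simple_tensor A a (1 / of_int i)" "y = simple_tensor A b (1 / of_int j)"
      "z = simple_tensor A c (1 / of_int k)"
    by (meson simple)
  have "p = 0 \<and> q = 0 \<and> r = 0" if rel: "of_int p * a + of_int q * b + of_int r * c = 0" for p q r :: int
  proof -
    \<comment> \<open>the factors \<open>i\<close>, \<open>j\<close>, \<open>k\<close> cancel the denominators of the three tensors\<close>
    define w :: "_ \<Rightarrow> rat" where "w = (\<lambda>v. if v = x then of_int (p * i) else if v = y then of_int (q * j)
       else if v = z then of_int (r * k) else 0)"
    have in_A: "of_int p * a \<in> A" "of_int q * b \<in> A" "of_int r * c \<in> A"
        "of_int p * a + of_int q * b \<in> A"
      using abc of_int_mult_closed[OF A] subgroup_add_groupD(2)[OF A] by auto
    have wx: "w x \<odot>\<^bsub>?V\<^esub> x = simple_tensor A (of_int p * a) 1"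
      and wy: "w y \<odot>\<^bsub>?V\<^esub> y = simple_tensor A (of_int q * b) 1"
      and wz: "w z \<odot>\<^bsub>?V\<^esub> z = simple_tensor A (of_int r * c) 1"
      using E abc by (auto simp: w_def xyz smult_simple_tensor[OF A] simple_tensor_of_int[OF A])
    have w0: "w v \<odot>\<^bsub>?V\<^esub> v = \<zero>\<^bsub>?V\<^esub>" if v: "v \<in> B - {x, y, z}" for v
    proof -
      obtain d n where "d \<in> A" "v = simple_tensor A d (1 / of_int n)"
        using tensor_rat_simple[OF A] carr v by blast
      then show ?thesis
        using v by (simp add: w_def smult_simple_tensor[OF A] A)
    qed
    have wc: "(\<lambda>v. w v \<odot>\<^bsub>?V\<^esub> v) \<in> {x, y, z} \<rightarrow> carrier ?V"
      using in_A by (auto simp: wx wy wz A)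
    have wB: "(\<lambda>v. w v \<odot>\<^bsub>?V\<^esub> v) \<in> B \<rightarrow> carrier ?V"
    proof
      fix v assume "v \<in> B"
      then show "w v \<odot>\<^bsub>?V\<^esub> v \<in> carrier ?V"
        using w0[of v] wc by (cases "v \<in> {x, y, z}") auto
    qed
    have "(\<Oplus>\<^bsub>?V\<^esub>v\<in>B. w v \<odot>\<^bsub>?V\<^esub> v) = (\<Oplus>\<^bsub>?V\<^esub>v\<in>{x, y, z}. w v \<odot>\<^bsub>?V\<^esub> v)"
      by (rule V.add.finprod_mono_neutral_cong_right) (use fin E w0 wB in auto)
    also have "\<dots> = simple_tensor A (of_int p * a) 1 \<oplus>\<^bsub>?V\<^esub>
        (simple_tensor A (of_int q * b) 1 \<oplus>\<^bsub>?V\<^esub> simple_tensor A (of_int r * c) 1)"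
      using E in_A wc by (simp add: wx wy wz A)
    also have "\<dots> = simple_tensor A (of_int p * a + of_int q * b + of_int r * c) 1"
      using in_A by (simp add: simple_tensor_add_left[OF A] A V.a_assoc)
    also have "\<dots> = \<zero>\<^bsub>?V\<^esub>" using rel by (simp add: A)
    finally have "\<forall>v\<in>B. w v = \<zero>\<^bsub>rat_field\<^esub>"
      using B(1) unfolding lin_independent_def by (auto simp: rat_field_def)
    then have "w x = 0" "w y = 0" "w z = 0"
      using E by (auto simp: rat_field_def)
    then show ?thesis
      using E abc by (auto simp: w_def)
  qed
  then show ?thesis
    unfolding int_independent_def using abc by blast
qed

section \<open>Functions with sparse differences under a dense group of translations\<close>

text \<open>
The group \<open>\<int>\<^sup>2\<close> has one end. All changes of \<open>G\<close> happen in a box \<open>\<bar>i\<bar>, \<bar>j\<bar> \<le> n\<close>; the rows and the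
columns that miss the box carry constant values, and any such row meets any such column.
\<close>

lemma finite_differences_imp_const_off_finite:
  fixes G :: "int \<Rightarrow> int \<Rightarrow> 'a"
  assumes "finite {(i, j). G (i + 1) j \<noteq> G i j}" and "finite {(i, j). G i (j + 1) \<noteq> G i j}"
  shows "\<exists>c. finite {(i, j). G i j \<noteq> c}"
proof -
  let ?D = "{(i, j). G (i + 1) j \<noteq> G i j} \<union> {(i, j). G i (j + 1) \<noteq> G i j}"
  have "finite ((\<lambda>(i, j). max \<bar>i\<bar> \<bar>j\<bar>) ` ?D)"
    by (intro finite_imageI finite_UnI assms)
  then have "bdd_above ((\<lambda>(i, j). max \<bar>i\<bar> \<bar>j\<bar>) ` ?D)"
    by (rule bdd_above_finite)
  then obtain n where bd: "\<forall>k \<in> (\<lambda>(i, j). max \<bar>i\<bar> \<bar>j\<bar>) ` ?D. k \<le> n"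
    unfolding bdd_above_def by (rule exE)
  have n: "max \<bar>i\<bar> \<bar>j\<bar> \<le> n" if "G (i + 1) j \<noteq> G i j \<or> G i (j + 1) \<noteq> G i j" for i j
    by (rule bspec[OF bd], rule image_eqI[of _ _ "(i, j)"]) (use that in auto)
  have row: "G i j = G 0 j" if j: "\<bar>j\<bar> > n" for i j
  proof -
    have step: "G (i + 1) j = G i j" for i
      using n[of i j] j by linarith
    show ?thesis
    proof (induction i rule: int_induct[of _ 0])
      case (step2 i)
      then show ?case using step[of "i - 1"] by simp
    qed (use step in auto)
  qed
  have col: "G i j = G i 0" if i: "\<bar>i\<bar> > n" for i j
  proof -
    have step: "G i (j + 1) = G i j" for j
      using n[of i j] i by linarith
    show ?thesis
    proof (induction j rule: int_induct[of _ 0])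
      case (step2 j)
      then show ?case using step[of "j - 1"] by simp
    qed (use step in auto)
  qed
  let ?m = "\<bar>n\<bar> + 1"
  have "G i j = G ?m ?m" if "\<bar>i\<bar> > n \<or> \<bar>j\<bar> > n" for i j
    using that
  proof
    assume "\<bar>i\<bar> > n"
    then show ?thesis using col[of i j] col[of i ?m] row[of ?m i] row[of ?m ?m] by simp
  next
    assume "\<bar>j\<bar> > n"
    then show ?thesis using row[of j i] row[of j ?m] col[of ?m j] col[of ?m ?m] by simp
  qed
  then have box: "\<bar>i\<bar> \<le> n \<and> \<bar>j\<bar> \<le> n" if "G i j \<noteq> G ?m ?m" for i j
    using that linorder_not_less by blast
  have "{(i, j). G i j \<noteq> G ?m ?m} \<subseteq> {-n..n} \<times> {-n..n}"
  proof (rule subsetI)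
    fix q assume "q \<in> {(i, j). G i j \<noteq> G ?m ?m}"
    then have "\<bar>fst q\<bar> \<le> n \<and> \<bar>snd q\<bar> \<le> n"
      by (intro box) (simp add: case_prod_unfold)
    then show "q \<in> {-n..n} \<times> {-n..n}" by (simp add: mem_Times_iff abs_le_iff)
  qed
  then have "finite {(i, j). G i j \<noteq> G ?m ?m}"
    by (rule finite_subset) simp
  then show ?thesis by (rule exI)
qed

text \<open>
The representative of \<open>x\<close> modulo \<open>a\<close> between \<open>0\<close> and \<open>a\<close>, for \<open>a\<close> of either sign.
\<close>

definition circle_rep :: "real \<Rightarrow> real \<Rightarrow> real" where
  "circle_rep a x = a * frac (x / a)"

lemma circle_rep_eq: "circle_rep a x = x - of_int \<lfloor>x / a\<rfloor> * a" if "a \<noteq> 0"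
  using that by (simp add: circle_rep_def frac_def algebra_simps)

lemma circle_rep_periodic: "circle_rep a (x + of_int k * a) = circle_rep a x" if "a \<noteq> 0"
proof -
  have "(x + of_int k * a) / a = x / a + of_int k" using that by (simp add: field_simps)
  then show ?thesis by (simp add: circle_rep_def frac_def)
qed

lemma abs_circle_rep_le: "\<bar>circle_rep a x\<bar> \<le> \<bar>a\<bar>"
proof -
  have "\<bar>frac (x / a)\<bar> \<le> 1" using frac_lt_1[of "x / a"] frac_ge_0[of "x / a"] by linarith
  then show ?thesis by (simp add: circle_rep_def abs_mult mult_left_le)
qed

text \<open>
Modulo \<open>a\<close>, the orbit of a point under \<open>\<int> a + \<int> b + \<int> c\<close> is a copy of \<open>\<int>\<^sup>2\<close> in a bounded interval.
\<close>

lemma inj_circle_rep_orbit: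
  assumes "int_independent a b c"
  shows "inj (\<lambda>(i, j). circle_rep a (x + of_int i * b + of_int j * c))"
proof (rule injI, clarify)
  have a: "a \<noteq> 0"
    using assms[unfolded int_independent_def, rule_format, of 1 0 0] by auto
  fix i j i' j' :: int
  let ?y = "x + of_int i * b + of_int j * c" and ?y' = "x + of_int i' * b + of_int j' * c"
  assume "circle_rep a ?y = circle_rep a ?y'"
  then have "of_int (\<lfloor>?y' / a\<rfloor> - \<lfloor>?y / a\<rfloor>) * a + of_int (i - i') * b + of_int (j - j') * c = 0"
    by (simp add: circle_rep_eq[OF a] algebra_simps)
  then show "i = i' \<and> j = j'"
    using assms unfolding int_independent_def by (metis eq_iff_diff_eq_0)
qed

lemma sparse_UNIV_iff:
  fixes S :: "real set"
  shows "S sparse_in UNIV \<longleftrightarrow> (\<forall>r. finite {x\<in>S. \<bar>x\<bar> \<le> r})"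
proof (intro iffI allI)
  fix r assume "S sparse_in UNIV"
  then have "finite ({-r..r} \<inter> S)"
    by (intro sparse_in_compact_finite) (auto intro: sparse_in_subset)
  then show "finite {x\<in>S. \<bar>x\<bar> \<le> r}"
    by (rule finite_subset[rotated]) auto
next
  assume fin: "\<forall>r. finite {x\<in>S. \<bar>x\<bar> \<le> r}"
  have "\<not> x islimpt S" for x
  proof
    assume "x islimpt S"
    then have "x islimpt (S \<inter> ball x 1)"
      by (intro islimpt_Int_eventually eventually_at_in_open') auto
    moreover have "S \<inter> ball x 1 \<subseteq> {y\<in>S. \<bar>y\<bar> \<le> \<bar>x\<bar> + 1}" by (auto simp: dist_real_def)
    ultimately show False
      using fin finite_subset islimpt_finite by blast
  qed
  then show "S sparse_in UNIV" by (simp add: sparse_in_open)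
qed

lemma sparse_translate: "S sparse_in UNIV \<Longrightarrow> {x. x - (d::real) \<in> S} sparse_in UNIV"
proof -
  have "{x. x - d \<in> S} = (+) d ` S" by force
  then show "S sparse_in UNIV \<Longrightarrow> ?thesis" using sparse_in_translate_UNIV by metis
qed

text \<open>
An orbit of \<open>\<int> a + \<int> b + \<int> c\<close> has infinitely many points in a bounded interval.
\<close>

lemma invariant_sparse_empty:
  assumes indep: "int_independent a b c" and sparse: "S sparse_in UNIV"
    and inv: "\<And>x k l m. x \<in> S \<Longrightarrow> x + of_int k * a + of_int l * b + of_int m * c \<in> S"
  shows "S = {}"
proof (rule ccontr)
  assume "S \<noteq> {}"
  then obtain x where x: "x \<in> S" by blast
  have a: "a \<noteq> 0"
    using indep[unfolded int_independent_def, rule_format, of 1 0 0] by auto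
  let ?f = "\<lambda>(i, j). circle_rep a (x + of_int i * b + of_int j * c)"
  have "range ?f \<subseteq> {y\<in>S. \<bar>y\<bar> \<le> \<bar>a\<bar>}"
  proof clarsimp
    fix i j :: int
    show "circle_rep a (x + of_int i * b + of_int j * c) \<in> S \<and>
        \<bar>circle_rep a (x + of_int i * b + of_int j * c)\<bar> \<le> \<bar>a\<bar>"
      using inv[OF x, of "- \<lfloor>(x + of_int i * b + of_int j * c) / a\<rfloor>" i j]
      by (simp add: abs_circle_rep_le) (simp add: circle_rep_eq[OF a] algebra_simps)
  qed
  then have "finite (range ?f)"
    using sparse finite_subset sparse_UNIV_iff by blast
  then have "finite (UNIV :: (int \<times> int) set)"
    using inj_circle_rep_orbit[OF indep] finite_imageD by blast
  then show False by (simp add: finite_prod)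
qed

text \<open>
The vanishing of \<open>H\<^sup>1\<close> with coefficients in the functions of sparse support. On the circle
\<open>\<real>/a\<int>\<close>, identified with a bounded fundamental interval, the rotations by \<open>b\<close> and \<open>c\<close> change
\<open>F\<close> at finitely many points only. On each rotation orbit, a copy of \<open>\<int>\<^sup>2\<close>, \<open>F\<close> is therefore constant off
a finite set; this constant is the value of \<open>C\<close>. An orbit on which \<open>F\<close> is not constant contains one of
the finitely many points where a rotation changes \<open>F\<close>, so \<open>F\<close> and \<open>C\<close> differ at finitely many points of the
circle. Since translation by \<open>k a\<close> changes \<open>F\<close> on a sparse set and a bounded interval involves finitely
many \<open>k\<close>, they differ on a sparse set of the line.
\<close>

lemma sparse_differences_imp_invariant_off_sparse:
  fixes F :: "real \<Rightarrow> 'a"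
  assumes A: "subgroup A (add_group UNIV)" and abc: "a \<in> A" "b \<in> A" "c \<in> A"
    and indep: "int_independent a b c"
    and diff: "\<And>g. g \<in> A \<Longrightarrow> {t. F (t - g) \<noteq> F t} sparse_in UNIV"
  shows "\<exists>C. (\<forall>t. \<forall>g\<in>A. C (t - g) = C t) \<and> {t. F t \<noteq> C t} sparse_in UNIV"
proof -
  have a0: "a \<noteq> 0"
    using indep[unfolded int_independent_def, rule_format, of 1 0 0] by auto
  define \<rho> where "\<rho> = circle_rep a"
  have \<rho>_eq: "\<rho> x = x - of_int \<lfloor>x / a\<rfloor> * a" for x
    using circle_rep_eq[OF a0] by (simp add: \<rho>_def)
  have \<rho>_shift: "\<rho> (x + of_int k * a) = \<rho> x" for x k
    using circle_rep_periodic[OF a0] by (simp add: \<rho>_def)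
  have \<rho>_bound: "\<bar>\<rho> x\<bar> \<le> \<bar>a\<bar>" for x
    using abs_circle_rep_le by (simp add: \<rho>_def)
  have \<rho>_add: "\<rho> (\<rho> x + y) = \<rho> (x + y)" for x y
    using \<rho>_shift[of "x + y" "- \<lfloor>x / a\<rfloor>"] by (simp add: \<rho>_eq[of x] algebra_simps)
  have \<rho>_idem: "\<rho> (\<rho> x) = \<rho> x" for x
    using \<rho>_add[of x 0] by simp
  have fin_diff: "finite {t. F (t - g) \<noteq> F t \<and> \<bar>t\<bar> \<le> r}" if "g \<in> A" for g r
    using diff[OF that] unfolding sparse_UNIV_iff by simp
  have fin_int: "finite {k::int. \<bar>of_int k * a\<bar> \<le> r}" for r
  proof (rule finite_subset)
    show "{k::int. \<bar>of_int k * a\<bar> \<le> r} \<subseteq> {- \<lceil>r / \<bar>a\<bar>\<rceil>..\<lceil>r / \<bar>a\<bar>\<rceil>}"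
    proof clarsimp
      fix k :: int assume "\<bar>of_int k * a\<bar> \<le> r"
      then have "\<bar>of_int k\<bar> \<le> r / \<bar>a\<bar>" using a0 by (simp add: field_simps abs_mult)
      then show "- \<lceil>r / \<bar>a\<bar>\<rceil> \<le> k \<and> k \<le> \<lceil>r / \<bar>a\<bar>\<rceil>" by linarith
    qed
  qed simp

  \<comment> \<open>the points of the fundamental interval at which rotation by \<open>d\<close> changes \<open>F\<close>\<close>
  define D where "D d = {y. \<rho> y = y \<and> F (\<rho> (y + d)) \<noteq> F y}" for d
  have fin_D: "finite (D d)" if d: "d \<in> A" for d
  proof (rule finite_subset)
    let ?K = "{k::int. \<bar>of_int k * a\<bar> \<le> 2 * \<bar>a\<bar> + \<bar>d\<bar>}"
    show "D d \<subseteq> (\<Union>k\<in>?K. {t. F (t - (of_int k * a - d)) \<noteq> F t \<and> \<bar>t\<bar> \<le> \<bar>a\<bar>})"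
    proof
      fix y assume y: "y \<in> D d"
      let ?k = "\<lfloor>(y + d) / a\<rfloor>"
      have "\<bar>y\<bar> \<le> \<bar>a\<bar>" using y \<rho>_bound[of y] by (simp add: D_def)
      moreover have "\<rho> (y + d) = y + d - of_int ?k * a" by (rule \<rho>_eq)
      moreover from this have "F (y - (of_int ?k * a - d)) \<noteq> F y"
        using y by (simp add: D_def diff_diff_eq2 add.commute)
      ultimately show "y \<in> (\<Union>k\<in>?K. {t. F (t - (of_int k * a - d)) \<noteq> F t \<and> \<bar>t\<bar> \<le> \<bar>a\<bar>})"
        using y \<rho>_bound[of "y + d"] by (intro UN_I[of ?k]) (auto simp: D_def algebra_simps)
    qed
    show "finite (\<Union>k\<in>?K. {t. F (t - (of_int k * a - d)) \<noteq> F t \<and> \<bar>t\<bar> \<le> \<bar>a\<bar>})"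
      using fin_int by (intro finite_UN_I fin_diff subgroup_add_groupD(4)[OF A] of_int_mult_closed[OF A] abc d)
  qed

  \<comment> \<open>\<open>p x\<close> parametrises the rotation orbit of \<open>x\<close> by \<open>\<int>\<^sup>2\<close>\<close>
  define p where "p x i j = \<rho> (x + of_int i * b + of_int j * c)" for x and i j :: int
  have inj_p: "inj (\<lambda>(i, j). p x i j)" for x
    using inj_circle_rep_orbit[OF indep] by (simp add: p_def \<rho>_def)
  have p_fix: "\<rho> (p x i j) = p x i j" for x i j
    by (simp add: p_def \<rho>_idem)
  have p_b: "\<rho> (p x i j + b) = p x (i + 1) j" and p_c: "\<rho> (p x i j + c) = p x i (j + 1)" for x i j
    unfolding p_def \<rho>_add by (simp_all add: algebra_simps)
  have p_shift: "p (x + of_int k * a + of_int l * b + of_int m * c) i j = p x (i + l) (j + m)" for x k l m i j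
    using \<rho>_shift[of "x + of_int (i + l) * b + of_int (j + m) * c" k]
    by (simp add: p_def algebra_simps)

  have "\<exists>v. finite {(i, j). F (p x i j) \<noteq> v}" for x
  proof (rule finite_differences_imp_const_off_finite)
    have "{(i, j). F (p x (i + 1) j) \<noteq> F (p x i j)} = (\<lambda>(i, j). p x i j) -` D b"
      by (auto simp: D_def p_fix p_b)
    then show "finite {(i, j). F (p x (i + 1) j) \<noteq> F (p x i j)}"
      using finite_vimageI[OF fin_D inj_p] abc by simp
    have "{(i, j). F (p x i (j + 1)) \<noteq> F (p x i j)} = (\<lambda>(i, j). p x i j) -` D c"
      by (auto simp: D_def p_fix p_c)
    then show "finite {(i, j). F (p x i (j + 1)) \<noteq> F (p x i j)}"
      using finite_vimageI[OF fin_D inj_p] abc by simp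
  qed
  then obtain C where C: "finite {(i, j). F (p x i j) \<noteq> C x}" for x
    by metis
  have C_unique: "C x = v" if "finite {(i, j). F (p x i j) \<noteq> v}" for x v
  proof (rule ccontr)
    assume "C x \<noteq> v"
    then have "(UNIV :: (int \<times> int) set) = {(i, j). F (p x i j) \<noteq> v} \<union> {(i, j). F (p x i j) \<noteq> C x}"
      by auto
    then have "finite (UNIV :: (int \<times> int) set)"
      using that C[of x] by (metis finite_UnI)
    then show False by (simp add: finite_prod)
  qed
  have C_shift: "C (x + of_int k * a + of_int l * b + of_int m * c) = C x" for x k l m
  proof (rule C_unique)
    have "inj (\<lambda>(i, j). (i + l, j + m))" by (auto simp: inj_def)
    from finite_vimageI[OF C[of x] this]
    show "finite {(i, j). F (p (x + of_int k * a + of_int l * b + of_int m * c) i j) \<noteq> C x}"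
      by (simp add: p_shift vimage_def case_prod_unfold)
  qed
  have C_p: "C (p x i j) = C x" for x i j
    using C_shift[of x "- \<lfloor>(x + of_int i * b + of_int j * c) / a\<rfloor>" i j]
    by (simp add: p_def \<rho>_eq algebra_simps)
  have C_\<rho>: "C (\<rho> x) = C x" for x
    using C_p[of x 0 0] by (simp add: p_def)

  let ?X = "{y. \<rho> y = y \<and> F y \<noteq> C y}"
  have fin_X: "finite ?X"
  proof (rule finite_subset)
    show "?X \<subseteq> (\<Union>z\<in>D b \<union> D c. (\<lambda>(i, j). p z i j) ` {(i, j). F (p z i j) \<noteq> C z})"
    proof
      fix y assume y: "y \<in> ?X"
      \<comment> \<open>otherwise \<open>F\<close> is constant on the orbit of \<open>y\<close>, with value \<open>F y\<close>\<close>
      have "\<exists>i j. p y i j \<in> D b \<union> D c"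
      proof (rule ccontr)
        assume "\<not> ?thesis"
        then have step: "F (p y (i + 1) j) = F (p y i j)" "F (p y i (j + 1)) = F (p y i j)" for i j
          by (auto simp: D_def p_fix p_b p_c)
        have 1: "F (p y i j) = F (p y 0 j)" for i j
        proof (induction i rule: int_induct[of _ 0])
          case (step2 i)
          then show ?case using step(1)[of "i - 1"] by simp
        qed (use step in auto)
        have 2: "F (p y 0 j) = F (p y 0 0)" for j
        proof (induction j rule: int_induct[of _ 0])
          case (step2 j)
          then show ?case using step(2)[of 0 "j - 1"] by simp
        qed (use step in auto)
        have "F (p y i j) = F y" for i j
          using 1[of i j] 2[of j] y by (simp add: p_def)
        then have "C y = F y" by (intro C_unique) simp
        then show False using y by simp
      qed
      then obtain i j where ij: "p y i j \<in> D b \<union> D c" by blast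
      have "p (p y i j) (- i) (- j) = y"
        using y \<rho>_add[of "y + of_int i * b + of_int j * c" "- of_int i * b - of_int j * c"]
        by (simp add: p_def algebra_simps)
      then show "y \<in> (\<Union>z\<in>D b \<union> D c. (\<lambda>(i, j). p z i j) ` {(i, j). F (p z i j) \<noteq> C z})"
        using y C_p[of y i j] by (intro UN_I[OF ij] image_eqI[of _ _ "(- i, - j)"]) auto
    qed
    show "finite (\<Union>z\<in>D b \<union> D c. (\<lambda>(i, j). p z i j) ` {(i, j). F (p z i j) \<noteq> C z})"
      using fin_D abc C by blast
  qed
  have sparse: "{t. F t \<noteq> C t} sparse_in UNIV"
    unfolding sparse_UNIV_iff
  proof (rule allI, rule finite_subset)
    fix r :: real
    let ?K = "{k::int. \<bar>of_int k * a\<bar> \<le> r + \<bar>a\<bar>}"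
    let ?U = "(\<Union>k\<in>?K. {t. F (t - of_int k * a) \<noteq> F t \<and> \<bar>t\<bar> \<le> r} \<union> (\<lambda>y. y + of_int k * a) ` ?X)"
    show "{x \<in> {t. F t \<noteq> C t}. \<bar>x\<bar> \<le> r} \<subseteq> ?U"
    proof
      fix t assume t: "t \<in> {x \<in> {t. F t \<noteq> C t}. \<bar>x\<bar> \<le> r}"
      let ?k = "\<lfloor>t / a\<rfloor>"
      have k: "?k \<in> ?K" and \<rho>t: "t = \<rho> t + of_int ?k * a"
        using t \<rho>_bound[of t] by (auto simp: \<rho>_eq)
      show "t \<in> ?U"
      proof (cases "F (\<rho> t) = F t")
        case True
        then have "\<rho> t \<in> ?X" using t by (simp add: \<rho>_idem C_\<rho>)
        then show ?thesis using k \<rho>t by blast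
      next
        case False
        then show ?thesis using t k by (intro UN_I[of ?k]) (auto simp: \<rho>_eq)
      qed
    qed
    show "finite ?U"
      using fin_X by (intro finite_UN_I finite_UnI fin_int fin_diff of_int_mult_closed[OF A abc(1)]) auto
  qed
  have "C (t - g) = C t" if g: "g \<in> A" for g t
  proof -
    \<comment> \<open>\<open>C\<close> is invariant under the three generators by construction; for the other
      elements of \<open>A\<close>, the set where invariance fails is sparse and invariant under the generators\<close>
    let ?S = "{t. C (t - g) \<noteq> C t}"
    have "?S = {}"
    proof (rule invariant_sparse_empty[OF indep])
      have "?S \<subseteq> {t. F t \<noteq> C t} \<union> {t. t - g \<in> {t. F t \<noteq> C t}} \<union> {t. F (t - g) \<noteq> F t}"
        by auto
      then show "?S sparse_in UNIV"
        using sparse diff[OF g] by (blast intro: sparse_in_subset2 sparse_in_union' sparse_translate)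
    next
      fix x :: real and k l m :: int
      assume "x \<in> ?S"
      then show "x + of_int k * a + of_int l * b + of_int m * c \<in> ?S"
        using C_shift[of x k l m] C_shift[of "x - g" k l m] by (simp add: algebra_simps)
    qed
    then show ?thesis by blast
  qed
  then show ?thesis using sparse by blast
qed

section \<open>Continuous functions on the split line\<close>

lemma continuous_map_discrete_binop:
  assumes "continuous_map X (discrete_topology UNIV) f" "continuous_map X (discrete_topology UNIV) g"
  shows "continuous_map X (discrete_topology UNIV) (\<lambda>x. h (f x) (g x))"
proof -
  have "continuous_map X (discrete_topology UNIV) (\<lambda>x. (f x, g x))"
    using continuous_map_pairedI[OF assms] by (simp flip: prod_topology_discrete_topology)
  then have "continuous_map X (discrete_topology UNIV) ((\<lambda>(u, v). h u v) \<circ> (\<lambda>x. (f x, g x)))"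
    by (rule continuous_map_compose) simp
  then show ?thesis by (simp add: o_def)
qed


text \<open>
The limits of the points over \<open>y\<close> as \<open>y\<close> tends to \<open>x\<close> from the right and from the left: they agree
exactly when \<open>x\<close> is not doubled. Every point of the split line is one of these, so that statements about it
need no distinction between regular and doubled points.
\<close>

definition right_pt :: "real set \<Rightarrow> real \<Rightarrow> split_point" where
  "right_pt \<Delta> x = (if x \<in> \<Delta> then Plus x else Regular x)"

definition left_pt :: "real set \<Rightarrow> real \<Rightarrow> split_point" where
  "left_pt \<Delta> x = (if x \<in> \<Delta> then Minus x else Regular x)"

lemma split_proj_pt [simp]: "split_proj (right_pt \<Delta> x) = x" "split_proj (left_pt \<Delta> x) = x"
  by (simp_all add: right_pt_def left_pt_def)

lemma pt_in_split_set [simp]: "right_pt \<Delta> x \<in> split_set \<Delta>" "left_pt \<Delta> x \<in> split_set \<Delta>"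
  by (auto simp: right_pt_def left_pt_def split_set_def)

lemma split_set_cases:
  assumes "z \<in> split_set \<Delta>"
  obtains "z = right_pt \<Delta> (split_proj z)" | "z = left_pt \<Delta> (split_proj z)"
  using assms by (auto simp: right_pt_def left_pt_def split_set_def)

lemma topspace_split_line [simp]: "topspace (split_line \<Delta>) = split_set \<Delta>"
  by (auto simp: split_line_def order_topology_on_def)

lemma openin_split_line_rays:
  assumes "a \<in> split_set \<Delta>"
  shows "openin (split_line \<Delta>) {y \<in> split_set \<Delta>. split_less a y}"
    and "openin (split_line \<Delta>) {y \<in> split_set \<Delta>. split_less y a}"
  unfolding split_line_def order_topology_on_def
  by (rule topology_generated_by_Basis; use assms in blast)+

text \<open>
The property is stable under unions and finite intersections, so it is enough to check it on rays.
\<close>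

lemma openin_split_line_one_sided:
  assumes "openin (split_line \<Delta>) W"
  shows "(right_pt \<Delta> x \<in> W \<longrightarrow> (\<forall>\<^sub>F y in at_right x. right_pt \<Delta> y \<in> W \<and> left_pt \<Delta> y \<in> W)) \<and>
    (left_pt \<Delta> x \<in> W \<longrightarrow> (\<forall>\<^sub>F y in at_left x. right_pt \<Delta> y \<in> W \<and> left_pt \<Delta> y \<in> W))"
proof -
  have "generate_topology_on ({split_set \<Delta>} \<union> {{y \<in> split_set \<Delta>. split_less a y} | a. a \<in> split_set \<Delta>} \<union>
      {{y \<in> split_set \<Delta>. split_less y a} | a. a \<in> split_set \<Delta>}) W"
    using assms unfolding split_line_def order_topology_on_def
    by (rule openin_topology_generated_by)
  then show ?thesis
  proof (induction rule: generate_topology_on.induct)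
    case (Int U V)
    then show ?case by (simp add: eventually_conj_iff)
  next
    case (UN K)
    show ?case
    proof (intro conjI impI)
      assume "right_pt \<Delta> x \<in> \<Union>K"
      then obtain U where U: "U \<in> K" "right_pt \<Delta> x \<in> U" by blast
      then have "\<forall>\<^sub>F y in at_right x. right_pt \<Delta> y \<in> U \<and> left_pt \<Delta> y \<in> U"
        using UN.IH[OF U(1)] by blast
      then show "\<forall>\<^sub>F y in at_right x. right_pt \<Delta> y \<in> \<Union>K \<and> left_pt \<Delta> y \<in> \<Union>K"
        by (rule eventually_mono) (use U(1) in blast)
    next
      assume "left_pt \<Delta> x \<in> \<Union>K"
      then obtain U where U: "U \<in> K" "left_pt \<Delta> x \<in> U" by blast
      then have "\<forall>\<^sub>F y in at_left x. right_pt \<Delta> y \<in> U \<and> left_pt \<Delta> y \<in> U"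
        using UN.IH[OF U(1)] by blast
      then show "\<forall>\<^sub>F y in at_left x. right_pt \<Delta> y \<in> \<Union>K \<and> left_pt \<Delta> y \<in> \<Union>K"
        by (rule eventually_mono) (use U(1) in blast)
    qed
  next
    case (Basis s)
    then consider "s = split_set \<Delta>"
      | a where "a \<in> split_set \<Delta>" "s = {y \<in> split_set \<Delta>. split_less a y}"
      | a where "a \<in> split_set \<Delta>" "s = {y \<in> split_set \<Delta>. split_less y a}"
      by blast
    then show ?case
    proof cases
      case (2 a)
      have "\<forall>\<^sub>F y in at_right x. right_pt \<Delta> y \<in> s \<and> left_pt \<Delta> y \<in> s" if "right_pt \<Delta> x \<in> s"
      proof -
        have "split_proj a \<le> x"
          using that 2 by (auto simp: split_less_def right_pt_def split: if_splits)
        then show ?thesis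
          using 2 unfolding eventually_at_right_field
          by (intro exI[of _ "x + 1"]) (auto simp: split_less_def)
      qed
      moreover have "\<forall>\<^sub>F y in at_left x. right_pt \<Delta> y \<in> s \<and> left_pt \<Delta> y \<in> s" if "left_pt \<Delta> x \<in> s"
      proof -
        have "split_proj a < x"
          using that 2 by (auto simp: split_less_def left_pt_def split: if_splits)
        then show ?thesis
          using 2 unfolding eventually_at_left_field
          by (intro exI[of _ "split_proj a"]) (auto simp: split_less_def)
      qed
      ultimately show ?thesis by blast
    next
      case (3 a)
      have "\<forall>\<^sub>F y in at_left x. right_pt \<Delta> y \<in> s \<and> left_pt \<Delta> y \<in> s" if "left_pt \<Delta> x \<in> s"
      proof -
        have "x \<le> split_proj a"
          using that 3 by (auto simp: split_less_def left_pt_def split: if_splits)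
        then show ?thesis
          using 3 unfolding eventually_at_left_field
          by (intro exI[of _ "x - 1"]) (auto simp: split_less_def)
      qed
      moreover have "\<forall>\<^sub>F y in at_right x. right_pt \<Delta> y \<in> s \<and> left_pt \<Delta> y \<in> s" if "right_pt \<Delta> x \<in> s"
      proof -
        have "x < split_proj a"
          using that 3 by (auto simp: split_less_def right_pt_def split: if_splits)
        then show ?thesis
          using 3 unfolding eventually_at_right_field
          by (intro exI[of _ "split_proj a"]) (auto simp: split_less_def)
      qed
      ultimately show ?thesis by blast
    qed auto
  qed auto
qed

text \<open>
A map to a discrete space is continuous iff it is locally constant. When the right and the left point
over \<open>x\<close> are distinct, they have neighbourhood bases that reach to one side of \<open>x\<close> only; when they agree,
the two one-sided conditions together amount to constancy near the point.
\<close>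

lemma continuous_map_split_line_iff:
  "continuous_map (split_line \<Delta>) (discrete_topology UNIV) f \<longleftrightarrow>
    (\<forall>x. (\<forall>\<^sub>F y in at_right x. f (right_pt \<Delta> y) = f (right_pt \<Delta> x) \<and> f (left_pt \<Delta> y) = f (right_pt \<Delta> x)) \<and>
         (\<forall>\<^sub>F y in at_left x. f (right_pt \<Delta> y) = f (left_pt \<Delta> x) \<and> f (left_pt \<Delta> y) = f (left_pt \<Delta> x)))"
    (is "?cont \<longleftrightarrow> (\<forall>x. ?R x \<and> ?L x)")
proof (intro iffI allI conjI)
  fix x assume ?cont
  then have op: "openin (split_line \<Delta>) {z \<in> split_set \<Delta>. f z = v}" for v
    using openin_continuous_map_preimage[of "split_line \<Delta>" "discrete_topology UNIV" f "{v}"] by simp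
  show "?R x" "?L x"
    using openin_split_line_one_sided[OF op[of "f (right_pt \<Delta> x)"], of x]
      openin_split_line_one_sided[OF op[of "f (left_pt \<Delta> x)"], of x] by simp_all
next
  assume loc: "\<forall>x. ?R x \<and> ?L x"
  have nbhd: "\<exists>T. openin (split_line \<Delta>) T \<and> z \<in> T \<and> (\<forall>w\<in>T. f w = f z)" if z: "z \<in> split_set \<Delta>" for z
  proof -
    let ?x = "split_proj z"
    have "?R ?x" "?L ?x" using loc by auto
    then obtain u v where u: "u > ?x" "\<And>y. y > ?x \<Longrightarrow> y < u \<Longrightarrow> f (right_pt \<Delta> y) = f (right_pt \<Delta> ?x) \<and> f (left_pt \<Delta> y) = f (right_pt \<Delta> ?x)"
      and v: "v < ?x" "\<And>y. y > v \<Longrightarrow> y < ?x \<Longrightarrow> f (right_pt \<Delta> y) = f (left_pt \<Delta> ?x) \<and> f (left_pt \<Delta> y) = f (left_pt \<Delta> ?x)"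
      unfolding eventually_at_right_field eventually_at_left_field by blast
    have right: "f w = f (right_pt \<Delta> ?x)" if "w \<in> split_set \<Delta>" "?x < split_proj w" "split_proj w < u" for w
      using that(1) by (cases rule: split_set_cases) (use u(2) that in metis)+
    have left: "f w = f (left_pt \<Delta> ?x)" if "w \<in> split_set \<Delta>" "v < split_proj w" "split_proj w < ?x" for w
      using that(1) by (cases rule: split_set_cases) (use v(2) that in metis)+
    \<comment> \<open>at a doubled point the twin of \<open>z\<close> serves as the endpoint on its side\<close>
    define lo where "lo = (if z = Plus ?x then Minus ?x else right_pt \<Delta> v)"
    define hi where "hi = (if z = Minus ?x then Plus ?x else left_pt \<Delta> u)"
    let ?T = "{w \<in> split_set \<Delta>. split_less lo w} \<inter> {w \<in> split_set \<Delta>. split_less w hi}"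
    have lohi: "lo \<in> split_set \<Delta>" "hi \<in> split_set \<Delta>"
      using z by (auto simp: lo_def hi_def split_set_def left_pt_def right_pt_def)
    have lo_z: "split_less lo z" and z_hi: "split_less z hi"
      using u v z by (auto simp: lo_def hi_def split_less_def)
    have "f w = f z" if w: "w \<in> ?T" for w
    proof -
      have ws: "w \<in> split_set \<Delta>" using w by blast
      have lw: "split_less lo w" and wh: "split_less w hi" using w by auto
      consider "split_proj w < ?x" | "split_proj w = ?x" | "split_proj w > ?x" by linarith
      then show ?thesis
      proof cases
        case 1
        then have nz: "z \<noteq> Plus ?x" and "v < split_proj w"
          using lw by (auto simp: lo_def split_less_def right_pt_def split: if_splits)
        moreover have "z = left_pt \<Delta> ?x"
          using z nz by (auto simp: split_set_def left_pt_def)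
        ultimately show ?thesis using left[OF ws] 1 by simp
      next
        case 2
        then have "w = z"
          using ws z lw wh
          by (cases z; cases w) (auto simp: lo_def hi_def split_set_def split_less_def)
        then show ?thesis by simp
      next
        case 3
        then have nz: "z \<noteq> Minus ?x" and "split_proj w < u"
          using wh by (auto simp: hi_def split_less_def left_pt_def split: if_splits)
        moreover have "z = right_pt \<Delta> ?x"
          using z nz by (auto simp: split_set_def right_pt_def)
        ultimately show ?thesis using right[OF ws] 3 by simp
      qed
    qed
    moreover have "openin (split_line \<Delta>) ?T"
      using openin_split_line_rays lohi by blast
    moreover have "z \<in> ?T" using z lo_z z_hi by blast
    ultimately show ?thesis by blast
  qed
  have "openin (split_line \<Delta>) {z \<in> split_set \<Delta>. f z \<in> U}" for U
  proof (subst openin_subopen, clarify)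
    fix z assume z: "z \<in> split_set \<Delta>" "f z \<in> U"
    obtain T where T: "openin (split_line \<Delta>) T" "z \<in> T" "\<forall>w\<in>T. f w = f z"
      using nbhd[OF z(1)] by (elim exE conjE) (rule that)
    have "T \<subseteq> {z \<in> split_set \<Delta>. f z \<in> U}"
    proof (intro subsetI CollectI conjI)
      fix w assume "w \<in> T"
      then show "w \<in> split_set \<Delta>" using openin_subset[OF T(1)] by auto
      show "f w \<in> U" using bspec[OF T(3) \<open>w \<in> T\<close>] z(2) by (rule ssubst)
    qed
    then show "\<exists>T. openin (split_line \<Delta>) T \<and> z \<in> T \<and> T \<subseteq> {z \<in> split_set \<Delta>. f z \<in> U}"
      using T by blast
  qed
  then show ?cont by (simp add: continuous_map_def)
qed

lemma split_translate_pt: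
  assumes "\<And>x. x + s \<in> \<Delta> \<longleftrightarrow> x \<in> \<Delta>"
  shows "split_translate s (right_pt \<Delta> x) = right_pt \<Delta> (x + s)"
    "split_translate s (left_pt \<Delta> x) = left_pt \<Delta> (x + s)"
  using assms by (simp_all add: right_pt_def left_pt_def)

lemma split_translate_in_split_set:
  assumes "\<And>x. x + s \<in> \<Delta> \<longleftrightarrow> x \<in> \<Delta>" "z \<in> split_set \<Delta>"
  shows "split_translate s z \<in> split_set \<Delta>"
  using assms by (auto simp: split_set_def)

lemma split_translate_add: "split_translate s (split_translate t z) = split_translate (t + s) z"
  by (cases z) (simp_all add: add.assoc)

lemma continuous_map_split_translate:
  assumes inv: "\<And>x. x + s \<in> \<Delta> \<longleftrightarrow> x \<in> \<Delta>"
    and f: "continuous_map (split_line \<Delta>) (discrete_topology UNIV) f"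
  shows "continuous_map (split_line \<Delta>) (discrete_topology UNIV) (\<lambda>z. f (split_translate s z))"
proof -
  have shift: "at_right (x + s) = filtermap (\<lambda>y. y + s) (at_right x)"
    "at_left (x + s) = filtermap (\<lambda>y. y + s) (at_left x)" for x
    using filtermap_at_right_shift[of "- s" x] filtermap_at_left_shift[of "- s" x] by simp_all
  have "\<forall>x. (\<forall>\<^sub>F y in at_right (x + s). f (right_pt \<Delta> y) = f (right_pt \<Delta> (x + s)) \<and> f (left_pt \<Delta> y) = f (right_pt \<Delta> (x + s))) \<and>
         (\<forall>\<^sub>F y in at_left (x + s). f (right_pt \<Delta> y) = f (left_pt \<Delta> (x + s)) \<and> f (left_pt \<Delta> y) = f (left_pt \<Delta> (x + s)))"
    using f unfolding continuous_map_split_line_iff by blast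
  then show ?thesis
    unfolding continuous_map_split_line_iff split_translate_pt[OF inv]
    by (simp add: shift eventually_filtermap)
qed

lemma sparse_jumps:
  assumes "continuous_map (split_line \<Delta>) (discrete_topology UNIV) f"
  shows "{x. f (right_pt \<Delta> x) \<noteq> f (left_pt \<Delta> x)} sparse_in UNIV"
  unfolding sparse_in_eventually_iff[OF open_UNIV] eventually_at_split
proof (intro ballI conjI)
  fix x
  have "\<forall>\<^sub>F y in at_left x. f (right_pt \<Delta> y) = f (left_pt \<Delta> x) \<and> f (left_pt \<Delta> y) = f (left_pt \<Delta> x)"
    and "\<forall>\<^sub>F y in at_right x. f (right_pt \<Delta> y) = f (right_pt \<Delta> x) \<and> f (left_pt \<Delta> y) = f (right_pt \<Delta> x)"
    using assms unfolding continuous_map_split_line_iff by blast+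
  then show "\<forall>\<^sub>F y in at_left x. y \<notin> {x. f (right_pt \<Delta> x) \<noteq> f (left_pt \<Delta> x)}"
    and "\<forall>\<^sub>F y in at_right x. y \<notin> {x. f (right_pt \<Delta> x) \<noteq> f (left_pt \<Delta> x)}"
    by (auto elim: eventually_mono)
qed

text \<open>
Without jumps, \<open>f\<close> descends to a locally constant function on the connected line \<open>\<real>\<close>.
\<close>

lemma no_jumps_imp_constant:
  assumes f: "continuous_map (split_line \<Delta>) (discrete_topology UNIV) f"
    and nj: "\<And>x. f (right_pt \<Delta> x) = f (left_pt \<Delta> x)"
    and "z \<in> split_set \<Delta>" "w \<in> split_set \<Delta>"
  shows "f z = f w"
proof -
  have const: "f (right_pt \<Delta> x) = f (right_pt \<Delta> y)" for x y
  proof (rule connected_local_const[of UNIV])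
    show "\<forall>x\<in>UNIV. \<forall>\<^sub>F y in at x. f (right_pt \<Delta> x) = f (right_pt \<Delta> y)"
      unfolding eventually_at_split
    proof (intro ballI conjI)
      fix x
      have "\<forall>\<^sub>F y in at_left x. f (right_pt \<Delta> y) = f (left_pt \<Delta> x)"
        and "\<forall>\<^sub>F y in at_right x. f (right_pt \<Delta> y) = f (right_pt \<Delta> x)"
        using f unfolding continuous_map_split_line_iff eventually_conj_iff by blast+
      then show "\<forall>\<^sub>F y in at_left x. f (right_pt \<Delta> x) = f (right_pt \<Delta> y)"
        and "\<forall>\<^sub>F y in at_right x. f (right_pt \<Delta> x) = f (right_pt \<Delta> y)"
        using nj[of x] by (auto elim: eventually_mono)
    qed
  qed auto
  have "f z = f (right_pt \<Delta> (split_proj z))" if "z \<in> split_set \<Delta>" for z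
    using that nj by (cases rule: split_set_cases) metis+
  then show ?thesis using assms const by metis
qed

text \<open>
The step function that sums \<open>J\<close> from \<open>0\<close>; sparseness makes the sums finite. It is right
continuous, so at a left point the jump at that point is subtracted again.
\<close>

lemma exists_continuous_with_jumps:
  fixes J :: "real \<Rightarrow> int"
  assumes sparse: "{x. J x \<noteq> 0} sparse_in UNIV" and supp: "\<And>x. x \<notin> \<Delta> \<Longrightarrow> J x = 0"
  shows "\<exists>f. continuous_map (split_line \<Delta>) (discrete_topology UNIV) f \<and>
    (\<forall>x. f (right_pt \<Delta> x) - f (left_pt \<Delta> x) = J x)"
proof -
  define S where "S = {x. J x \<noteq> 0}"
  \<comment> \<open>\<open>I a b\<close> is the increment of the step function from \<open>a\<close> to \<open>b\<close>\<close>
  define I where "I a b = sum J (S \<inter> {a<..b})" for a b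
  have fin: "finite (S \<inter> {a<..b})" for a b
  proof (rule finite_subset)
    show "S \<inter> {a<..b} \<subseteq> {a..b} \<inter> S" by auto
    show "finite ({a..b} \<inter> S)"
      using sparse_in_subset[OF sparse] by (intro sparse_in_compact_finite) (auto simp: S_def)
  qed
  have I_add: "I a c = I a b + I b c" if "a \<le> b" "b \<le> c" for a b c
  proof -
    have "S \<inter> {a<..c} = (S \<inter> {a<..b}) \<union> (S \<inter> {b<..c})" using that by auto
    then show ?thesis
      unfolding I_def using fin by (simp add: sum.union_disjoint disjoint_iff)
  qed
  have I_empty: "I a b = 0" if "b \<le> a" for a b using that by (simp add: I_def)
  define g where "g x = I 0 x - I x 0" for x
  have g_diff: "g y - g x = I x y" if "x \<le> y" for x y
  proof -
    consider "0 \<le> x" | "x \<le> 0" "0 \<le> y" | "y \<le> 0" by linarith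
    then show ?thesis
    proof cases
      case 1
      then show ?thesis
        using I_add[OF 1 that] I_empty[of 0 x] I_empty[of 0 y] that unfolding g_def by linarith
    next
      case 2
      then show ?thesis
        using I_add[OF 2] I_empty[of 0 y] I_empty[of x 0] unfolding g_def by linarith
    next
      case 3
      then show ?thesis
        using I_add[OF that 3] I_empty[of x 0] I_empty[of y 0] that unfolding g_def by linarith
    qed
  qed
  define f where "f z = g (split_proj z) - (case z of Minus t \<Rightarrow> J t | _ \<Rightarrow> 0)" for z
  have fR: "f (right_pt \<Delta> x) = g x" and fL: "f (left_pt \<Delta> x) = g x - J x" for x
    using supp by (auto simp: f_def right_pt_def left_pt_def)
  have ev: "\<forall>\<^sub>F y in at x. J y = 0" for x
    using sparse unfolding sparse_in_eventually_iff[OF open_UNIV] by simp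
  have "continuous_map (split_line \<Delta>) (discrete_topology UNIV) f"
    unfolding continuous_map_split_line_iff fR fL
  proof (intro allI conjI)
    fix x
    obtain u where u: "u > x" "\<And>y. y > x \<Longrightarrow> y < u \<Longrightarrow> J y = 0"
      using ev[of x] unfolding eventually_at_split eventually_at_right_field by blast
    have "g y = g x \<and> g y - J y = g x" if y: "x < y" "y < u" for y
    proof -
      have "I x y = 0"
        unfolding I_def using u(2) y by (intro sum.neutral) auto
      then show ?thesis using g_diff[of x y] u(2)[of y] y by simp
    qed
    then show "\<forall>\<^sub>F y in at_right x. g y = g x \<and> g y - J y = g x"
      unfolding eventually_at_right_field using u(1) by blast
    obtain v where v: "v < x" "\<And>y. y > v \<Longrightarrow> y < x \<Longrightarrow> J y = 0"
      using ev[of x] unfolding eventually_at_split eventually_at_left_field by blast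
    have "g y = g x - J x \<and> g y - J y = g x - J x" if y: "v < y" "y < x" for y
    proof -
      have "S \<inter> {y<..x} \<subseteq> {x}"
      proof
        fix t assume t: "t \<in> S \<inter> {y<..x}"
        then have "\<not> t < x" using v(2)[of t] y by (auto simp: S_def)
        then show "t \<in> {x}" using t by simp
      qed
      then have "I y x = sum J {x}"
        unfolding I_def using y by (intro sum.mono_neutral_left) (auto simp: S_def)
      then show ?thesis using g_diff[of y x] v(2)[of y] y by simp
    qed
    then show "\<forall>\<^sub>F y in at_left x. g y = g x - J x \<and> g y - J y = g x - J x"
      unfolding eventually_at_left_field using v(1) by blast
  qed
  then show ?thesis using fR fL by auto
qed

section \<open>Cocycles on the split line\<close>

text \<open>
All functions on a free \<open>A\<close>-set form a coinduced module: after a choice of a base point on each orbit,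
\<open>F t\<close> is the value of the cocycle on the translation from the base point to \<open>t\<close>.
\<close>

lemma add_subgroup_cocycle_is_coboundary:
  fixes c :: "'g::ab_group_add \<Rightarrow> 'g \<Rightarrow> 'b::ab_group_add"
  assumes A: "subgroup A (add_group UNIV)"
    and cocycle: "\<And>g h t. g \<in> A \<Longrightarrow> h \<in> A \<Longrightarrow> c (g + h) t = c g t + c h (t - g)"
  shows "\<exists>F. \<forall>g\<in>A. \<forall>t. c g t = F t - F (t - g)"
proof -
  define rep where "rep t = (SOME s. t - s \<in> A)" for t
  have rep: "t - rep t \<in> A" for t
    unfolding rep_def by (rule someI[of _ t]) (use subgroup_add_groupD[OF A] in simp)
  have rep_shift: "rep (t - g) = rep t" if "g \<in> A" for t g
  proof -
    have "t - g - s \<in> A \<longleftrightarrow> t - s \<in> A" for s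
      using subgroup_add_groupD(2)[OF A _ that, of "t - g - s"]
        subgroup_add_groupD(4)[OF A _ that, of "t - s"] by (auto simp: algebra_simps)
    then show ?thesis by (simp add: rep_def)
  qed
  have "c g t = c (t - rep t) t - c (t - g - rep (t - g)) (t - g)" if g: "g \<in> A" for g t
    using cocycle[OF g rep[of "t - g"], of t] by (simp add: rep_shift[OF g])
  then show ?thesis by (intro exI[of _ "\<lambda>t. c (t - rep t) t"]) blast
qed

text \<open>
The jumps of a cocycle form a cocycle with values in functions on \<open>\<real>\<close>, hence a coboundary of some \<open>F\<close>.
Correcting \<open>F\<close> by an invariant function gives a primitive \<open>J\<close> of sparse support, which is the
jump function of some continuous \<open>f\<close>. Subtracting the coboundary of \<open>f\<close> leaves a cocycle without
jumps; it is constant on the split line, hence a homomorphism.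
\<close>

lemma split_line_cocycle_decomposition:
  fixes \<xi> :: "split_point \<Rightarrow> real \<Rightarrow> int"
  assumes A: "subgroup A (add_group UNIV)" and abc: "a \<in> A" "b \<in> A" "c \<in> A"
    and indep: "int_independent a b c"
    and inv: "\<And>t s. t \<in> \<Delta> \<Longrightarrow> s \<in> A \<Longrightarrow> t + s \<in> \<Delta>"
    and cont: "\<And>g. g \<in> A \<Longrightarrow> continuous_map (split_line \<Delta>) (discrete_topology UNIV) (\<lambda>z. \<xi> z g)"
    and cocycle: "\<And>z g h. z \<in> split_set \<Delta> \<Longrightarrow> g \<in> A \<Longrightarrow> h \<in> A \<Longrightarrow>
        \<xi> z (g + h) = \<xi> z g + \<xi> (split_translate (- g) z) h"
  shows "\<exists>\<phi> f. continuous_map (split_line \<Delta>) (discrete_topology UNIV) f \<and>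
    (\<forall>g\<in>A. \<forall>h\<in>A. \<phi> (g + h) = \<phi> g + \<phi> h) \<and>
    (\<forall>z\<in>split_set \<Delta>. \<forall>g\<in>A. \<xi> z g = \<phi> g + (f z - f (split_translate (- g) z)))"
proof -
  have mem: "x + s \<in> \<Delta> \<longleftrightarrow> x \<in> \<Delta>" if "s \<in> A" for x s
    by (rule shift_invariant_mem_iff[OF A _ that]) (rule inv)
  have negA: "- g \<in> A" if "g \<in> A" for g using subgroup_add_groupD(3)[OF A that] .
  have trR: "split_translate (- g) (right_pt \<Delta> t) = right_pt \<Delta> (t - g)"
    and trL: "split_translate (- g) (left_pt \<Delta> t) = left_pt \<Delta> (t - g)" if "g \<in> A" for g t
    using split_translate_pt[OF mem, OF negA[OF that]] by simp_all
  define j where "j g t = \<xi> (right_pt \<Delta> t) g - \<xi> (left_pt \<Delta> t) g" for g t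
  have "j (g + h) t = j g t + j h (t - g)" if "g \<in> A" "h \<in> A" for g h t
    using that by (simp add: j_def cocycle trR trL)
  then obtain F where F: "j g t = F t - F (t - g)" if "g \<in> A" for g t
    using add_subgroup_cocycle_is_coboundary[OF A, of j] by metis
  have "{t. F (t - g) \<noteq> F t} sparse_in UNIV" if "g \<in> A" for g
  proof -
    have "F (t - g) \<noteq> F t \<longleftrightarrow> \<xi> (right_pt \<Delta> t) g \<noteq> \<xi> (left_pt \<Delta> t) g" for t
      using F[OF that, of t] by (auto simp: j_def)
    then show ?thesis using sparse_jumps[OF cont[OF that]] by simp
  qed
  from sparse_differences_imp_invariant_off_sparse[OF A abc indep this]
  obtain C where C: "\<And>t g. g \<in> A \<Longrightarrow> C (t - g) = C t" and sp: "{t. F t \<noteq> C t} sparse_in UNIV"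
    by blast
  define J where "J t = F t - C t" for t
  have J_sparse: "{t. J t \<noteq> 0} sparse_in UNIV" using sp by (simp add: J_def)
  have J_diff: "J t - J (t - g) = j g t" if "g \<in> A" for g t
    using F[OF that, of t] C[OF that, of t] by (simp add: J_def)
  \<comment> \<open>off \<open>\<Delta>\<close> there are no jumps, so \<open>J\<close> is invariant there\<close>
  have "{t. t \<notin> \<Delta> \<and> J t \<noteq> 0} = {}"
  proof (rule invariant_sparse_empty[OF indep])
    show "{t. t \<notin> \<Delta> \<and> J t \<noteq> 0} sparse_in UNIV"
      by (rule sparse_in_subset2[OF J_sparse]) auto
  next
    fix x :: real and k l m :: int
    define u where "u = of_int k * a + of_int l * b + of_int m * c"
    assume x: "x \<in> {t. t \<notin> \<Delta> \<and> J t \<noteq> 0}"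
    have u: "u \<in> A"
      unfolding u_def by (intro subgroup_add_groupD(2)[OF A] of_int_mult_closed[OF A] abc)
    have "j (- u) x = 0" using x by (simp add: j_def right_pt_def left_pt_def)
    then have "J (x + u) = J x" using J_diff[OF negA[OF u], of x] by simp
    then show "x + of_int k * a + of_int l * b + of_int m * c \<in> {t. t \<notin> \<Delta> \<and> J t \<noteq> 0}"
      using x mem[OF u, of x] by (simp add: u_def add.assoc)
  qed
  then have "J t = 0" if "t \<notin> \<Delta>" for t using that by blast
  then obtain f where f: "continuous_map (split_line \<Delta>) (discrete_topology UNIV) f"
    and fJ: "\<And>t. f (right_pt \<Delta> t) - f (left_pt \<Delta> t) = J t"
    using exists_continuous_with_jumps[OF J_sparse] by blast
  define h where "h g z = \<xi> z g - (f z - f (split_translate (- g) z))" for g z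
  have h_const: "h g z = h g (right_pt \<Delta> 0)" if g: "g \<in> A" and z: "z \<in> split_set \<Delta>" for g z
  proof (rule no_jumps_imp_constant)
    show "continuous_map (split_line \<Delta>) (discrete_topology UNIV) (h g)"
      unfolding h_def
      by (intro continuous_map_discrete_binop[where h = minus] cont f continuous_map_split_translate mem negA g)
    show "h g (right_pt \<Delta> x) = h g (left_pt \<Delta> x)" for x
      using J_diff[OF g, of x] fJ[of x] fJ[of "x - g"] by (simp add: h_def trR trL g j_def)
  qed (use z in auto)
  define \<phi> where "\<phi> g = h g (right_pt \<Delta> 0)" for g
  have \<xi>_eq: "\<xi> z g = \<phi> g + (f z - f (split_translate (- g) z))" if "z \<in> split_set \<Delta>" "g \<in> A" for z g
    using h_const[OF that(2,1)] by (simp add: \<phi>_def h_def)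
  have "\<phi> (g + k) = \<phi> g + \<phi> k" if g: "g \<in> A" and k: "k \<in> A" for g k
  proof -
    let ?z = "right_pt \<Delta> 0"
    have "split_translate (- g) ?z \<in> split_set \<Delta>" by (simp add: trR[OF g])
    then show ?thesis
      using cocycle[of ?z g k] \<xi>_eq[of ?z "g + k"] \<xi>_eq[of ?z g] \<xi>_eq[of "split_translate (- g) ?z" k]
        g k subgroup_add_groupD(2)[OF A g k] by (simp add: split_translate_add)
  qed
  then show ?thesis using f \<xi>_eq by blast
qed

text \<open>
If the coboundary of \<open>f\<close> is constant in the space variable, then the jump set of \<open>f\<close> is invariant;
being sparse, it is empty, and \<open>f\<close> is constant.
\<close>

lemma split_line_coboundary_character_zero:
  fixes f :: "split_point \<Rightarrow> int"
  assumes A: "subgroup A (add_group UNIV)" and abc: "a \<in> A" "b \<in> A" "c \<in> A"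
    and indep: "int_independent a b c"
    and inv: "\<And>t s. t \<in> \<Delta> \<Longrightarrow> s \<in> A \<Longrightarrow> t + s \<in> \<Delta>"
    and f: "continuous_map (split_line \<Delta>) (discrete_topology UNIV) f"
    and eq: "\<And>z g. z \<in> split_set \<Delta> \<Longrightarrow> g \<in> A \<Longrightarrow> \<phi> g = f z - f (split_translate (- g) z)"
    and g: "g \<in> A"
  shows "\<phi> g = 0"
proof -
  have mem: "x + s \<in> \<Delta> \<longleftrightarrow> x \<in> \<Delta>" if "s \<in> A" for x s
    by (rule shift_invariant_mem_iff[OF A _ that]) (rule inv)
  have negA: "- g \<in> A" if "g \<in> A" for g using subgroup_add_groupD(3)[OF A that] .
  let ?S = "{x. f (right_pt \<Delta> x) \<noteq> f (left_pt \<Delta> x)}"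
  have "?S = {}"
  proof (rule invariant_sparse_empty[OF indep sparse_jumps[OF f]])
    fix x :: real and k l m :: int
    define u where "u = of_int k * a + of_int l * b + of_int m * c"
    assume x: "x \<in> ?S"
    have u: "u \<in> A"
      unfolding u_def by (intro subgroup_add_groupD(2)[OF A] of_int_mult_closed[OF A] abc)
    have "f (right_pt \<Delta> (x + u)) \<noteq> f (left_pt \<Delta> (x + u))"
      using eq[of "right_pt \<Delta> x" "- u"] eq[of "left_pt \<Delta> x" "- u"] x negA[OF u]
      by (simp add: split_translate_pt[OF mem[OF u]])
    then show "x + of_int k * a + of_int l * b + of_int m * c \<in> ?S"
      by (simp add: u_def add.assoc)
  qed
  then have "f (right_pt \<Delta> x) = f (left_pt \<Delta> x)" for x by blast
  then have "f (right_pt \<Delta> 0) = f (split_translate (- g) (right_pt \<Delta> 0))"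
    by (rule no_jumps_imp_constant[OF f])
      (rule pt_in_split_set(1), rule split_translate_in_split_set[OF mem[OF negA[OF g]] pt_in_split_set(1)])
  then show ?thesis using eq[of "right_pt \<Delta> 0" g] g by simp
qed

section \<open>First cohomology of transformation groupoids\<close>

lemma continuous_map_prod_discrete_iff:
  "continuous_map (prod_topology X (discrete_topology S)) Y f \<longleftrightarrow>
    (\<forall>s\<in>S. continuous_map X Y (\<lambda>x. f (x, s)))"
proof (intro iffI ballI)
  fix s assume f: "continuous_map (prod_topology X (discrete_topology S)) Y f" and s: "s \<in> S"
  have "continuous_map X (prod_topology X (discrete_topology S)) (\<lambda>x. (x, s))"
    using s by (intro continuous_map_pairedI) auto
  then show "continuous_map X Y (\<lambda>x. f (x, s))"
    using continuous_map_compose[OF _ f] by (simp add: o_def)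
next
  assume sections: "\<forall>s\<in>S. continuous_map X Y (\<lambda>x. f (x, s))"
  show "continuous_map (prod_topology X (discrete_topology S)) Y f"
    unfolding continuous_map_def
  proof (intro conjI allI impI)
    show "f \<in> topspace (prod_topology X (discrete_topology S)) \<rightarrow> topspace Y"
      using sections by (auto simp: continuous_map_def Pi_iff)
    fix U assume "openin Y U"
    then have "openin (prod_topology X (discrete_topology S)) ({x \<in> topspace X. f (x, s) \<in> U} \<times> {s})"
      if "s \<in> S" for s
      using sections that by (auto simp: openin_prod_Times_iff continuous_map_def)
    then have "openin (prod_topology X (discrete_topology S))
        (\<Union>s\<in>S. {x \<in> topspace X. f (x, s) \<in> U} \<times> {s})"
      by blast
    also have "(\<Union>s\<in>S. {x \<in> topspace X. f (x, s) \<in> U} \<times> {s}) =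
        {z \<in> topspace (prod_topology X (discrete_topology S)). f z \<in> U}"
      by auto
    finally show "openin (prod_topology X (discrete_topology S))
        {z \<in> topspace (prod_topology X (discrete_topology S)). f z \<in> U}" .
  qed
qed

lemma Z1_simps:
  "carrier (Z1 \<G>) = int_homs \<G>"
  "\<xi> \<otimes>\<^bsub>Z1 \<G>\<^esub> \<eta> = (\<lambda>g\<in>arrows \<G>. \<xi> g + \<eta> g)"
  "\<one>\<^bsub>Z1 \<G>\<^esub> = (\<lambda>g\<in>arrows \<G>. 0)"
  by (simp_all add: Z1_def)

lemma int_homsI:
  assumes "\<And>g h. g \<in> arrows \<G> \<Longrightarrow> h \<in> arrows \<G> \<Longrightarrow> src \<G> g = rng \<G> h \<Longrightarrow> gcomp \<G> g h \<in> arrows \<G>"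
    and "continuous_map (arr_top \<G>) (discrete_topology UNIV) \<xi>"
    and "\<And>g h. g \<in> arrows \<G> \<Longrightarrow> h \<in> arrows \<G> \<Longrightarrow> src \<G> g = rng \<G> h \<Longrightarrow>
      \<xi> (gcomp \<G> g h) = \<xi> g + \<xi> h"
  shows "restrict \<xi> (arrows \<G>) \<in> int_homs \<G>"
  using assms continuous_map_eq[OF assms(2), of "restrict \<xi> (arrows \<G>)"]
  unfolding int_homs_def by simp

lemma int_homsD:
  assumes "\<xi> \<in> int_homs \<G>"
  shows "\<xi> \<in> extensional (arrows \<G>)" "continuous_map (arr_top \<G>) (discrete_topology UNIV) \<xi>"
    "\<And>g h. g \<in> arrows \<G> \<Longrightarrow> h \<in> arrows \<G> \<Longrightarrow> src \<G> g = rng \<G> h \<Longrightarrow> \<xi> (gcomp \<G> g h) = \<xi> g + \<xi> h"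
  using assms by (auto simp: int_homs_def)

lemma comm_group_Z1:
  assumes closed: "\<And>g h. g \<in> arrows \<G> \<Longrightarrow> h \<in> arrows \<G> \<Longrightarrow> src \<G> g = rng \<G> h \<Longrightarrow> gcomp \<G> g h \<in> arrows \<G>"
  shows "comm_group (Z1 \<G>)"
proof (rule comm_groupI; unfold Z1_simps)
  fix \<xi> \<eta> assume "\<xi> \<in> int_homs \<G>" "\<eta> \<in> int_homs \<G>"
  then show "(\<lambda>g\<in>arrows \<G>. \<xi> g + \<eta> g) \<in> int_homs \<G>"
    by (intro int_homsI closed continuous_map_discrete_binop[where h = plus])
       (simp_all add: int_homsD)
next
  show "(\<lambda>g\<in>arrows \<G>. 0) \<in> int_homs \<G>"
    by (intro int_homsI closed) simp_all
next
  fix \<xi> assume \<xi>: "\<xi> \<in> int_homs \<G>"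
  then show "(\<lambda>g\<in>arrows \<G>. (\<lambda>g\<in>arrows \<G>. 0) g + \<xi> g) = \<xi>"
    by (intro extensionalityI[of _ "arrows \<G>"]) (auto dest: int_homsD(1))
  have "(\<lambda>g\<in>arrows \<G>. 0 - \<xi> g) \<in> int_homs \<G>"
    using \<xi> by (intro int_homsI closed continuous_map_discrete_binop[where h = minus])
       (simp_all add: int_homsD)
  then show "\<exists>\<eta>\<in>int_homs \<G>. (\<lambda>g\<in>arrows \<G>. \<eta> g + \<xi> g) = (\<lambda>g\<in>arrows \<G>. 0)"
    by (rule bexI[rotated]) auto
qed (auto simp: fun_eq_iff restrict_def)

text \<open>
The coboundaries of a group are trivial, so its first cohomology consists of singleton cosets.
\<close>

lemma iso_of_singleton_cosets:
  assumes G: "Group.group G" and \<Psi>: "\<Psi> \<in> iso G K" and M: "\<And>x. x \<in> carrier G \<Longrightarrow> M {x} = \<Psi> x"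
  shows "M \<in> iso (G Mod {\<one>\<^bsub>G\<^esub>}) K"
proof -
  interpret G: Group.group G by fact
  have coset: "{\<one>\<^bsub>G\<^esub>} #>\<^bsub>G\<^esub> x = {x}" if "x \<in> carrier G" for x
    using that by (auto simp: r_coset_def)
  have carr: "carrier (G Mod {\<one>\<^bsub>G\<^esub>}) = (\<lambda>x. {x}) ` carrier G"
    using coset by (auto simp: carrier_FactGroup)
  have \<Psi>_hom: "\<Psi> \<in> hom G K" and \<Psi>_bij: "bij_betw \<Psi> (carrier G) (carrier K)"
    using \<Psi> by (auto simp: iso_def)
  have "M \<in> hom (G Mod {\<one>\<^bsub>G\<^esub>}) K"
  proof (rule homI)
    fix X Y assume "X \<in> carrier (G Mod {\<one>\<^bsub>G\<^esub>})" "Y \<in> carrier (G Mod {\<one>\<^bsub>G\<^esub>})"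
    then obtain x y where xy: "x \<in> carrier G" "y \<in> carrier G" "X = {x}" "Y = {y}"
      unfolding carr by blast
    then have "X \<otimes>\<^bsub>G Mod {\<one>\<^bsub>G\<^esub>}\<^esub> Y = {x \<otimes>\<^bsub>G\<^esub> y}"
      by (simp add: FactGroup_def set_mult_def)
    then show "M (X \<otimes>\<^bsub>G Mod {\<one>\<^bsub>G\<^esub>}\<^esub> Y) = M X \<otimes>\<^bsub>K\<^esub> M Y"
      using xy M hom_mult[OF \<Psi>_hom] by simp
  qed (use M hom_in_carrier[OF \<Psi>_hom] in \<open>auto simp: carr\<close>)
  moreover have "bij_betw M (carrier (G Mod {\<one>\<^bsub>G\<^esub>})) (carrier K)"
  proof -
    have "bij_betw (M \<circ> (\<lambda>x. {x})) (carrier G) (carrier K)"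
      by (rule bij_betw_cong[THEN iffD2, OF _ \<Psi>_bij]) (simp add: M)
    moreover have "bij_betw (\<lambda>x. {x}) (carrier G) (carrier (G Mod {\<one>\<^bsub>G\<^esub>}))"
      unfolding carr by (rule bij_betw_imageI) (auto simp: inj_on_def)
    ultimately show ?thesis
      by (simp add: bij_betw_comp_iff)
  qed
  ultimately show ?thesis by (simp add: iso_def)
qed

lemma Z1_group_groupoid: "Z1 (group_groupoid G) = Hom_int G"
  by (auto simp: Z1_def Hom_int_def int_homs_def group_groupoid_def hom_def integer_group_def)

lemma B1_group_groupoid: "B1 (group_groupoid G) = {\<one>\<^bsub>Hom_int G\<^esub>}"
proof -
  have eq: "(\<lambda>g\<in>arrows (group_groupoid G). f (rng (group_groupoid G) g) - f (src (group_groupoid G) g))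
      = \<one>\<^bsub>Hom_int G\<^esub>" for f :: "'a \<Rightarrow> int"
    by (simp add: Hom_int_def group_groupoid_def)
  show ?thesis
  proof (intro equalityI subsetI)
    fix \<beta> assume "\<beta> \<in> B1 (group_groupoid G)"
    then show "\<beta> \<in> {\<one>\<^bsub>Hom_int G\<^esub>}" unfolding B1_def using eq by blast
  next
    fix \<beta> assume "\<beta> \<in> {\<one>\<^bsub>Hom_int G\<^esub>}"
    then have "\<beta> = (\<lambda>g\<in>arrows (group_groupoid G). 0 - 0)"
      using eq[of "\<lambda>_. 0"] by simp
    then show "\<beta> \<in> B1 (group_groupoid G)"
      unfolding B1_def by (intro CollectI exI[of _ "\<lambda>_. 0"] conjI) simp_all
  qed
qed

lemma H1_rigidI:
  assumes G: "Group.group G"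
    and iso: "(\<lambda>\<phi>. H1_class (transformation_groupoid X G act) (\<phi> \<circ> snd))
      \<in> iso (Hom_int G) (H1 (transformation_groupoid X G act))"
  shows "H1_rigid X G act"
proof -
  interpret G: Group.group G by fact
  have "comm_group (Z1 (group_groupoid G))"
    by (rule comm_group_Z1) (auto simp: group_groupoid_def)
  then have "Group.group (Hom_int G)"
    unfolding Z1_group_groupoid by (rule comm_group.axioms(2))
  then show ?thesis
    unfolding H1_rigid_def H1_def[of "group_groupoid G"] Z1_group_groupoid B1_group_groupoid
    by (rule iso_of_singleton_cosets[OF _ iso]) (simp add: H1_map_def)
qed

text \<open>
Continuity of the action is expressed through the integer-valued continuous functions, which is the
form in which coboundaries use it.
\<close>

locale abelian_action =
  fixes X :: "'x topology" and G :: "'g monoid" (structure) and act :: "'g \<Rightarrow> 'x \<Rightarrow> 'x"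
  assumes comm: "comm_group G"
    and act_closed: "g \<in> carrier G \<Longrightarrow> x \<in> topspace X \<Longrightarrow> act g x \<in> topspace X"
    and act_mult: "g \<in> carrier G \<Longrightarrow> h \<in> carrier G \<Longrightarrow> x \<in> topspace X \<Longrightarrow>
      act (g \<otimes>\<^bsub>G\<^esub> h) x = act g (act h x)"
    and act_continuous: "g \<in> carrier G \<Longrightarrow> continuous_map X (discrete_topology UNIV) f \<Longrightarrow>
      continuous_map X (discrete_topology UNIV) (\<lambda>x. f (act g x) :: int)"
begin

sublocale comm_group G by (rule comm)

abbreviation \<H> where "\<H> \<equiv> transformation_groupoid X G act"

lemma \<H>_simps:
  "arr_top \<H> = prod_topology X (discrete_topology (carrier G))"
  "gunits \<H> = topspace X \<times> {\<one>}"
  "rng \<H> (x, g) = (x, \<one>)"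
  "src \<H> (x, g) = (act (inv g) x, \<one>)"
  "gcomp \<H> (x, g) (y, h) = (x, g \<otimes> h)"
  by (simp_all add: transformation_groupoid_def)

lemma arrows_\<H>: "arrows \<H> = topspace X \<times> carrier G"
  by (simp add: \<H>_simps)

definition coboundary :: "('x \<Rightarrow> int) \<Rightarrow> 'x \<times> 'g \<Rightarrow> int" where
  "coboundary f = (\<lambda>(x, g)\<in>arrows \<H>. f x - f (act (inv g) x))"

lemma B1_eq: "B1 \<H> = coboundary ` {f. continuous_map X (discrete_topology UNIV) f}"
proof -
  have incl: "continuous_map X (unit_top \<H>) (\<lambda>x. (x, \<one>))"
    unfolding unit_top_def \<H>_simps
    by (intro continuous_map_into_subtopology continuous_map_pairedI) auto
  have proj: "continuous_map (unit_top \<H>) X fst"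
    unfolding unit_top_def \<H>_simps
    by (intro continuous_map_from_subtopology continuous_map_fst)
  show ?thesis
  proof (intro equalityI subsetI)
    fix \<beta> assume "\<beta> \<in> B1 \<H>"
    then obtain f where f: "continuous_map (unit_top \<H>) (discrete_topology UNIV) f"
      and \<beta>: "\<beta> = (\<lambda>g\<in>arrows \<H>. f (rng \<H> g) - f (src \<H> g))"
      unfolding B1_def by blast
    have "\<beta> = coboundary (\<lambda>x. f (x, \<one>))"
      unfolding \<beta> coboundary_def by (auto simp: fun_eq_iff restrict_def \<H>_simps)
    moreover have "continuous_map X (discrete_topology UNIV) (\<lambda>x. f (x, \<one>))"
      using continuous_map_compose[OF incl f] by (simp add: o_def)
    ultimately show "\<beta> \<in> coboundary ` {f. continuous_map X (discrete_topology UNIV) f}"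
      by blast
  next
    fix \<beta> assume "\<beta> \<in> coboundary ` {f. continuous_map X (discrete_topology UNIV) f}"
    then obtain f where f: "continuous_map X (discrete_topology UNIV) f" and \<beta>: "\<beta> = coboundary f"
      by blast
    have "\<beta> = (\<lambda>g\<in>arrows \<H>. (f \<circ> fst) (rng \<H> g) - (f \<circ> fst) (src \<H> g))"
      unfolding \<beta> coboundary_def by (auto simp: fun_eq_iff restrict_def \<H>_simps)
    then show "\<beta> \<in> B1 \<H>"
      unfolding B1_def using continuous_map_compose[OF proj f] by (intro CollectI exI[of _ "f \<circ> fst"] conjI)
  qed
qed

lemma gcomp_closed:
  "\<And>g h. g \<in> arrows \<H> \<Longrightarrow> h \<in> arrows \<H> \<Longrightarrow> src \<H> g = rng \<H> h \<Longrightarrow> gcomp \<H> g h \<in> arrows \<H>"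
  by (auto simp: \<H>_simps)

lemma comm_group_Z1_\<H>: "comm_group (Z1 \<H>)"
  by (rule comm_group_Z1) (rule gcomp_closed)

lemma coboundary_in_Z1:
  assumes "continuous_map X (discrete_topology UNIV) f"
  shows "coboundary f \<in> int_homs \<H>"
  unfolding coboundary_def
proof (rule int_homsI[OF gcomp_closed])
  show "continuous_map (arr_top \<H>) (discrete_topology UNIV) (\<lambda>(x, g). f x - f (act (inv g) x))"
    unfolding \<H>_simps continuous_map_prod_discrete_iff
    using assms by (auto intro!: continuous_map_discrete_binop[where h = minus] act_continuous)
qed (auto simp: \<H>_simps inv_mult_group act_mult inv_mult)

lemma subgroup_B1: "subgroup (B1 \<H>) (Z1 \<H>)"
proof -
  interpret Z: comm_group "Z1 \<H>" by (rule comm_group_Z1_\<H>)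
  show ?thesis
  proof (rule Z.subgroupI)
    show "B1 \<H> \<subseteq> carrier (Z1 \<H>)"
      unfolding B1_eq Z1_simps using coboundary_in_Z1 by blast
    have "continuous_map X (discrete_topology UNIV) (\<lambda>_. 0 :: int)" by simp
    then show "B1 \<H> \<noteq> {}" unfolding B1_eq by blast
  next
    fix \<beta> assume "\<beta> \<in> B1 \<H>"
    then obtain f where f: "continuous_map X (discrete_topology UNIV) f" and \<beta>: "\<beta> = coboundary f"
      unfolding B1_eq by blast
    have cont: "continuous_map X (discrete_topology UNIV) (\<lambda>x. 0 - f x)"
      using f by (intro continuous_map_discrete_binop[where h = minus]) simp_all
    have "coboundary (\<lambda>x. 0 - f x) \<otimes>\<^bsub>Z1 \<H>\<^esub> \<beta> = \<one>\<^bsub>Z1 \<H>\<^esub>"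
      unfolding Z1_simps \<beta> coboundary_def by (auto simp: fun_eq_iff restrict_def)
    then have "inv\<^bsub>Z1 \<H>\<^esub> \<beta> = coboundary (\<lambda>x. 0 - f x)"
      by (rule Z.inv_equality)
        (unfold Z1_simps(1) \<beta>, rule coboundary_in_Z1[OF f], rule coboundary_in_Z1[OF cont])
    then show "inv\<^bsub>Z1 \<H>\<^esub> \<beta> \<in> B1 \<H>"
      unfolding B1_eq using cont by blast
  next
    fix \<beta> \<beta>' assume "\<beta> \<in> B1 \<H>" "\<beta>' \<in> B1 \<H>"
    then obtain f f' where f: "continuous_map X (discrete_topology UNIV) f" "\<beta> = coboundary f"
      "continuous_map X (discrete_topology UNIV) f'" "\<beta>' = coboundary f'"
      unfolding B1_eq by blast
    have eq: "\<beta> \<otimes>\<^bsub>Z1 \<H>\<^esub> \<beta>' = coboundary (\<lambda>x. f x + f' x)"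
      unfolding Z1_simps f coboundary_def by (auto simp: fun_eq_iff restrict_def)
    show "\<beta> \<otimes>\<^bsub>Z1 \<H>\<^esub> \<beta>' \<in> B1 \<H>"
      unfolding B1_eq eq
      by (intro imageI CollectI continuous_map_discrete_binop[where h = plus] f)
  qed
qed

lemma pullback_in_Z1:
  assumes "\<phi> \<in> carrier (Hom_int G)"
  shows "restrict (\<phi> \<circ> snd) (arrows \<H>) \<in> int_homs \<H>"
proof (rule int_homsI[OF gcomp_closed])
  show "continuous_map (arr_top \<H>) (discrete_topology UNIV) (\<phi> \<circ> snd)"
    unfolding \<H>_simps continuous_map_prod_discrete_iff by simp
qed (use assms in \<open>auto simp: \<H>_simps Hom_int_def hom_def integer_group_def\<close>)

text \<open>
Coboundaries come from functions on the space (\<open>B1_eq\<close>), so \<open>inj\<close> gives triviality of the kernel,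
and \<open>surj\<close> finds the pullback of a homomorphism in every coset.
\<close>

lemma H1_class_iso:
  assumes inj: "\<And>\<phi> f. \<phi> \<in> carrier (Hom_int G) \<Longrightarrow> continuous_map X (discrete_topology UNIV) f \<Longrightarrow>
      (\<And>x g. x \<in> topspace X \<Longrightarrow> g \<in> carrier G \<Longrightarrow> \<phi> g = f x - f (act (inv g) x)) \<Longrightarrow>
      (\<And>g. g \<in> carrier G \<Longrightarrow> \<phi> g = 0)"
    and surj: "\<And>\<xi>. \<xi> \<in> int_homs \<H> \<Longrightarrow> \<exists>\<phi>\<in>carrier (Hom_int G). \<exists>f.
      continuous_map X (discrete_topology UNIV) f \<and>
      (\<forall>x\<in>topspace X. \<forall>g\<in>carrier G. \<xi> (x, g) = \<phi> g + (f x - f (act (inv g) x)))"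
  shows "(\<lambda>\<phi>. H1_class \<H> (\<phi> \<circ> snd)) \<in> iso (Hom_int G) (H1 \<H>)"
proof -
  interpret Z: comm_group "Z1 \<H>" by (rule comm_group_Z1_\<H>)
  have normal: "B1 \<H> \<lhd> Z1 \<H>" by (rule Z.subgroup_imp_normal[OF subgroup_B1])
  have Hom: "comm_group (Hom_int G)"
    using comm_group_Z1[of "group_groupoid G"] 
    by (simp add: Z1_group_groupoid) (simp add: group_groupoid_def)
  define \<iota> where "\<iota> \<phi> = restrict (\<phi> \<circ> snd) (arrows \<H>)" for \<phi> :: "'g \<Rightarrow> int"
  have \<iota>_in: "\<iota> \<phi> \<in> carrier (Z1 \<H>)" if "\<phi> \<in> carrier (Hom_int G)" for \<phi>
    using pullback_in_Z1[OF that] by (simp add: \<iota>_def Z1_simps)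
  have \<iota>_hom: "\<iota> \<in> hom (Hom_int G) (Z1 \<H>)"
  proof (rule homI)
    show "\<iota> (\<phi> \<otimes>\<^bsub>Hom_int G\<^esub> \<psi>) = \<iota> \<phi> \<otimes>\<^bsub>Z1 \<H>\<^esub> \<iota> \<psi>" for \<phi> \<psi>
      by (auto simp: \<iota>_def Z1_simps Hom_int_def fun_eq_iff restrict_def arrows_\<H>)
  qed (rule \<iota>_in)
  have class_eq: "H1_class \<H> (\<phi> \<circ> snd) = B1 \<H> #>\<^bsub>Z1 \<H>\<^esub> \<iota> \<phi>" for \<phi>
    by (simp add: H1_class_def \<iota>_def)
  have hom: "(\<lambda>\<phi>. H1_class \<H> (\<phi> \<circ> snd)) \<in> hom (Hom_int G) (H1 \<H>)"
  proof -
    have "(\<lambda>\<phi>. H1_class \<H> (\<phi> \<circ> snd)) = (\<lambda>\<xi>. B1 \<H> #>\<^bsub>Z1 \<H>\<^esub> \<xi>) \<circ> \<iota>"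
      by (rule ext) (simp only: class_eq o_apply)
    then show ?thesis
      using Group.hom_compose[OF \<iota>_hom normal.r_coset_hom_Mod[OF normal]] by (simp only: H1_def)
  qed
  interpret h: group_hom "Hom_int G" "H1 \<H>" "\<lambda>\<phi>. H1_class \<H> (\<phi> \<circ> snd)"
    using hom Hom normal.factorgroup_is_group[OF normal]
    by (simp add: group_hom_def group_hom_axioms_def comm_group_def H1_def)
  have "inj_on (\<lambda>\<phi>. H1_class \<H> (\<phi> \<circ> snd)) (carrier (Hom_int G))"
    unfolding h.inj_on_one_iff
  proof (intro allI impI)
    fix \<phi> assume \<phi>: "\<phi> \<in> carrier (Hom_int G)" and "H1_class \<H> (\<phi> \<circ> snd) = \<one>\<^bsub>H1 \<H>\<^esub>"
    then have "B1 \<H> #>\<^bsub>Z1 \<H>\<^esub> \<iota> \<phi> = B1 \<H>"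
      by (simp add: class_eq H1_def FactGroup_def)
    then have "\<iota> \<phi> \<in> B1 \<H>"
      using Z.rcos_self[OF \<iota>_in[OF \<phi>] subgroup_B1] by simp
    then obtain f where f: "continuous_map X (discrete_topology UNIV) f" "\<iota> \<phi> = coboundary f"
      unfolding B1_eq by blast
    have "\<phi> g = f x - f (act (inv g) x)" if "x \<in> topspace X" "g \<in> carrier G" for x g
      using fun_cong[OF f(2), of "(x, g)"] that by (simp add: \<iota>_def coboundary_def \<H>_simps)
    then have "\<phi> g = 0" if "g \<in> carrier G" for g
      using inj[OF \<phi> f(1)] that by blast
    then show "\<phi> = \<one>\<^bsub>Hom_int G\<^esub>"
      using \<phi> by (auto simp: Hom_int_def fun_eq_iff restrict_def extensional_def)
  qed
  moreover have "carrier (H1 \<H>) \<subseteq> (\<lambda>\<phi>. H1_class \<H> (\<phi> \<circ> snd)) ` carrier (Hom_int G)"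
  proof
    fix K assume "K \<in> carrier (H1 \<H>)"
    then obtain \<xi> where \<xi>: "\<xi> \<in> int_homs \<H>" "K = B1 \<H> #>\<^bsub>Z1 \<H>\<^esub> \<xi>"
      by (auto simp: H1_def carrier_FactGroup Z1_simps)
    obtain \<phi> f where \<phi>: "\<phi> \<in> carrier (Hom_int G)" and f: "continuous_map X (discrete_topology UNIV) f"
      and eq: "\<And>x g. x \<in> topspace X \<Longrightarrow> g \<in> carrier G \<Longrightarrow> \<xi> (x, g) = \<phi> g + (f x - f (act (inv g) x))"
      using surj[OF \<xi>(1)] by blast
    have "\<xi> = coboundary f \<otimes>\<^bsub>Z1 \<H>\<^esub> \<iota> \<phi>"
    proof (rule extensionalityI)
      show "\<xi> \<in> extensional (arrows \<H>)" by (rule int_homsD(1)[OF \<xi>(1)])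
      show "\<xi> z = (coboundary f \<otimes>\<^bsub>Z1 \<H>\<^esub> \<iota> \<phi>) z" if "z \<in> arrows \<H>" for z
        using that eq by (cases z) (simp add: Z1_simps coboundary_def \<iota>_def arrows_\<H>)
    qed (simp add: Z1_simps)
    then have "\<xi> \<in> B1 \<H> #>\<^bsub>Z1 \<H>\<^esub> \<iota> \<phi>"
      using f by (auto simp: r_coset_def B1_eq)
    then have "B1 \<H> #>\<^bsub>Z1 \<H>\<^esub> \<iota> \<phi> = K"
      using Z.repr_independence[OF _ \<iota>_in[OF \<phi>] subgroup_B1] \<xi> by simp
    then show "K \<in> (\<lambda>\<phi>. H1_class \<H> (\<phi> \<circ> snd)) ` carrier (Hom_int G)"
      using \<phi> class_eq by blast
  qed
  ultimately show ?thesis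
    using hom hom_carrier[OF hom] by (auto simp: iso_def bij_betw_def)
qed

end

section \<open>Rigidity of the translation action\<close>

lemma abelian_action_split_line:
  assumes A: "subgroup A (add_group UNIV)" and inv: "\<And>t s. t \<in> \<Delta> \<Longrightarrow> s \<in> A \<Longrightarrow> t + s \<in> \<Delta>"
  shows "abelian_action (split_line \<Delta>) (add_group A) split_translate"
proof (rule abelian_action.intro)
  have mem: "x + s \<in> \<Delta> \<longleftrightarrow> x \<in> \<Delta>" if "s \<in> A" for x s
    by (rule shift_invariant_mem_iff[OF A _ that]) (rule inv)
  show "comm_group (add_group A)" by (rule comm_group_add_group[OF A])
  show "split_translate g x \<in> topspace (split_line \<Delta>)"
    if "g \<in> carrier (add_group A)" "x \<in> topspace (split_line \<Delta>)" for g x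
    using split_translate_in_split_set[OF mem] that by simp
  show "continuous_map (split_line \<Delta>) (discrete_topology UNIV) (\<lambda>x. f (split_translate g x) :: int)"
    if "g \<in> carrier (add_group A)" "continuous_map (split_line \<Delta>) (discrete_topology UNIV) f" for g f
    using continuous_map_split_translate[OF mem] that by simp
qed (simp add: split_translate_add add.commute)

theorem lemma4p3:
  fixes \<Gamma> \<Delta> :: "real set"
  assumes "subgroup \<Gamma> (add_group UNIV)" and "countable \<Gamma>" and "closure \<Gamma> = UNIV"
    and "countable \<Delta>" and "closure \<Delta> = UNIV" and "0 \<in> \<Delta>"
    and "\<And>t s. t \<in> \<Delta> \<Longrightarrow> s \<in> \<Gamma> \<Longrightarrow> t + s \<in> \<Delta>"
    and "group_rank (add_group \<Gamma>) \<ge> 3"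
  defines "\<H> \<equiv> transformation_groupoid (split_line \<Delta>) (add_group \<Gamma>) split_translate"
  shows "H1_rigid (split_line \<Delta>) (add_group \<Gamma>) split_translate \<and>
    (\<lambda>\<phi>. H1_class \<H> (\<phi> \<circ> snd)) \<in> iso (Hom_int (add_group \<Gamma>)) (H1 \<H>)"
proof -
  note A = assms(1) and inv = assms(7)
  obtain a b c where abc: "a \<in> \<Gamma>" "b \<in> \<Gamma>" "c \<in> \<Gamma>" and indep: "int_independent a b c"
    using group_rank_ge_3_imp_int_independent[OF A assms(8)] by blast
  interpret T: abelian_action "split_line \<Delta>" "add_group \<Gamma>" split_translate
    by (rule abelian_action_split_line[OF A inv])
  have iso: "(\<lambda>\<phi>. H1_class \<H> (\<phi> \<circ> snd)) \<in> iso (Hom_int (add_group \<Gamma>)) (H1 \<H>)"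
    unfolding \<H>_def
  proof (rule T.H1_class_iso)
    fix \<phi> :: "real \<Rightarrow> int" and f g
    assume f: "continuous_map (split_line \<Delta>) (discrete_topology UNIV) f"
      and eq: "\<And>x g. x \<in> topspace (split_line \<Delta>) \<Longrightarrow> g \<in> carrier (add_group \<Gamma>) \<Longrightarrow>
        \<phi> g = f x - f (split_translate (inv\<^bsub>add_group \<Gamma>\<^esub> g) x)"
      and g: "g \<in> carrier (add_group \<Gamma>)"
    have eq': "\<phi> g = f z - f (split_translate (- g) z)" if "z \<in> split_set \<Delta>" "g \<in> \<Gamma>" for z g
      using eq[of z g] that by (simp add: inv_add_group[OF A])
    show "\<phi> g = 0"
      by (rule split_line_coboundary_character_zero[OF A abc indep inv f eq']) (use g in auto)
  next
    fix \<xi> assume "\<xi> \<in> int_homs (transformation_groupoid (split_line \<Delta>) (add_group \<Gamma>) split_translate)"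
    note \<xi> = int_homsD[OF this, unfolded T.arrows_\<H>]
    have cont: "continuous_map (split_line \<Delta>) (discrete_topology UNIV) (\<lambda>z. \<xi> (z, g))" if "g \<in> \<Gamma>" for g
      using \<xi>(2) that by (simp add: T.\<H>_simps continuous_map_prod_discrete_iff)
    have mem: "x + s \<in> \<Delta> \<longleftrightarrow> x \<in> \<Delta>" if "s \<in> \<Gamma>" for x s
      by (rule shift_invariant_mem_iff[OF A _ that]) (rule inv)
    have cocycle: "\<xi> (z, g + h) = \<xi> (z, g) + \<xi> (split_translate (- g) z, h)"
      if "z \<in> split_set \<Delta>" "g \<in> \<Gamma>" "h \<in> \<Gamma>" for z g h
    proof -
      have "split_translate (- g) z \<in> split_set \<Delta>"
        using split_translate_in_split_set[OF mem[OF subgroup_add_groupD(3)[OF A that(2)]] that(1)] .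
      then show ?thesis
        using \<xi>(3)[of "(z, g)" "(split_translate (- g) z, h)"] that
        by (simp add: T.\<H>_simps inv_add_group[OF A])
    qed
    have "\<exists>\<phi> f. continuous_map (split_line \<Delta>) (discrete_topology UNIV) f \<and>
        (\<forall>g\<in>\<Gamma>. \<forall>h\<in>\<Gamma>. \<phi> (g + h) = \<phi> g + \<phi> h) \<and>
        (\<forall>z\<in>split_set \<Delta>. \<forall>g\<in>\<Gamma>. \<xi> (z, g) = \<phi> g + (f z - f (split_translate (- g) z)))"
      by (rule split_line_cocycle_decomposition[OF A abc indep inv cont cocycle])
    then obtain \<phi> f where f: "continuous_map (split_line \<Delta>) (discrete_topology UNIV) f"
      and \<phi>: "\<forall>g\<in>\<Gamma>. \<forall>h\<in>\<Gamma>. \<phi> (g + h) = \<phi> g + \<phi> h"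
      and eq: "\<forall>z\<in>split_set \<Delta>. \<forall>g\<in>\<Gamma>. \<xi> (z, g) = \<phi> g + (f z - f (split_translate (- g) z))"
      by (elim exE conjE) (rule that)
    have "restrict \<phi> \<Gamma> \<in> carrier (Hom_int (add_group \<Gamma>))"
      using \<phi> subgroup_add_groupD(2)[OF A] by (auto simp: Hom_int_def hom_def integer_group_def)
    moreover have "\<forall>x\<in>topspace (split_line \<Delta>). \<forall>g\<in>carrier (add_group \<Gamma>).
        \<xi> (x, g) = restrict \<phi> \<Gamma> g + (f x - f (split_translate (inv\<^bsub>add_group \<Gamma>\<^esub> g) x))"
      using eq by (simp add: inv_add_group[OF A])
    ultimately show "\<exists>\<phi>\<in>carrier (Hom_int (add_group \<Gamma>)). \<exists>f.
        continuous_map (split_line \<Delta>) (discrete_topology UNIV) f \<and>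
        (\<forall>x\<in>topspace (split_line \<Delta>). \<forall>g\<in>carrier (add_group \<Gamma>).
          \<xi> (x, g) = \<phi> g + (f x - f (split_translate (inv\<^bsub>add_group \<Gamma>\<^esub> g) x)))"
      using f by blast
  qed
  moreover have "H1_rigid (split_line \<Delta>) (add_group \<Gamma>) split_translate"
    using H1_rigidI[OF comm_group.axioms(2)[OF comm_group_add_group[OF A]]] iso
    unfolding \<H>_def by blast
  ultimately show ?thesis by blast
qed

end
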